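(* For all $p,q,r\ge 0$ with $n=p+q+r\ge 1$, the group $\mathrm{P}^{\Lambda}_{p,q,r}$ has the following equivalent definitions (it equals each of the following three sets): (a) $(\mathcal{G}^{(0)\times}_{p,q,r}\cup\mathcal{G}^{(1)\times}_{p,q,r})(\mathcal{G}^{0}\oplus\mathcal{G}^{n}_{p,q,r})^{\times}\Lambda_r^{\times}$ if $n$ is odd, and $(\mathcal{G}^{(0)\times}_{p,q,r}\cup\mathcal{G}^{(1)\times}_{p,q,r})\Lambda_r^{\times}$ if $n$ is even; (b) $\{T\in\mathcal{G}^{\times}_{p,q,r}:\ \widehat{T^{-1}}T\in(\Lambda_r\oplus\mathcal{G}^{n}_{p,q,r})^{\times}\}$ if $n$ is odd and $r\neq n$, and $\{T\in\mathcal{G}^{\times}_{p,q,r}:\ \widehat{T^{-1}}T\in\Lambda_r^{\times}\}$ if $n$ is even or $r=n$; (c) $\{T\in\mathcal{G}^{\times}_{p,q,r}:\ \widehat{T^{-1}}T\in(\Lambda_r\oplus\mathcal{G}^{n}_{p,q,r})^{\times}\}$ if $r\neq n$, and $\Lambda_n^{\times}$ if $r=n$. The group $\mathrm{P}^{\pm\Lambda}_{p,q,r}$ has the following equivalent definitions (it equals each of the following three sets): (a') $(\mathcal{G}^{(0)\times}_{p,q,r}\cup\mathcal{G}^{(1)\times}_{p,q,r})\Lambda_r^{\times}$; (b') $\{T\in\mathcal{G}^{\times}_{p,q,r}:\ \widehat{T^{-1}}T\in\Lambda_r^{\times}\}$; (c') $\{T\in\mathcal{G}^{\times}_{p,q,r}:\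 \widehat{T^{-1}}T\in\Lambda_r^{\times}\}$ if $n$ is odd or $r=n$, and $\{T\in\mathcal{G}^{\times}_{p,q,r}:\ \widehat{T^{-1}}T\in(\Lambda_r\oplus\mathcal{G}^{n}_{p,q,r})^{\times}\}$ if $n$ is even and $r\neq n$. Here $\Lambda_r^{\times}=\ker(\tilde{\mathrm{ad}})$.
   Context: Let $\mathbb{F}=\mathbb{R}$ or $\mathbb{F}=\mathbb{C}$, let $p,q,r\ge 0$ be integers and $n=p+q+r\ge 1$. $\mathcal{G}_{p,q,r}$ denotes the (Clifford) geometric algebra: the unital associative $\mathbb{F}$-algebra of dimension $2^n$ with identity $e$ and generators $e_1,\dots,e_n$ satisfying $e_ae_b+e_be_a=2\eta_{ab}e$, where $\eta$ is the diagonal matrix whose diagonal is $p$ times $1$, then $q$ times $-1$, then $r$ times $0$ (if $\mathbb{F}=\mathbb{R}$), or $p+q$ times $1$, then $r$ times $0$ (if $\mathbb{F}=\mathbb{C}$). A basis is given by $e_{a_1\ldots a_k}:=e_{a_1}\cdots e_{a_k}$, $a_1<\dots<a_k$, $0\le k\le n$ (the empty product being $e$); $\mathcal{G}^k_{p,q,r}$ (grade $k$) is the span of those with $k$ indices, and $\mathcal{G}^0=\mathbb{F}e$. The grade involution $U\mapsto\widehat U$ is the algebra automorphism with $\widehat{e_a}=-e_a$. $\mathcal{G}^{(k)}_{p,q,r}=\{U:\widehat U=(-1)^kU\}$, $k=0,1$ (even and odd subspaces). $\Lambda_r=\mathcal{G}_{0,0,r}$ is the (Grassmann) subalgebra generated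 by $e$ and the null generators $e_{p+q+1},\dots,e_n$ ($\Lambda_0=\mathcal{G}^0$). For a subset $A\subseteq\mathcal{G}_{p,q,r}$, $A^\times$ denotes the set of elements of $A$ invertible in $\mathcal{G}_{p,q,r}$. A product of subsets is the set of products of their elements. $\mathrm{Z}_{p,q,r}$ is the center of $\mathcal{G}_{p,q,r}$; it equals $\Lambda^{(0)}_r\oplus\mathcal{G}^n_{p,q,r}$ if $n$ is odd and $\Lambda^{(0)}_r$ if $n$ is even, where $\Lambda_r^{(0)}=\Lambda_r\cap\mathcal{G}^{(0)}_{p,q,r}$. Groups: $\mathrm{P}^{\pm}_{p,q,r}:=\mathcal{G}^{(0)\times}_{p,q,r}\cup\mathcal{G}^{(1)\times}_{p,q,r}$, $\mathrm{P}_{p,q,r}:=\mathrm{P}^{\pm}_{p,q,r}\mathrm{Z}^{\times}_{p,q,r}$, $\mathrm{P}^{\pm\Lambda}_{p,q,r}:=\mathrm{P}^{\pm}_{p,q,r}\Lambda_r^{\times}$, $\mathrm{P}^{\Lambda}_{p,q,r}:=\mathrm{P}_{p,q,r}\Lambda_r^{\times}$. The twisted adjoint representation $\tilde{\mathrm{ad}}$ is, for $T\in\mathcal{G}^\times_{p,q,r}$, $\tilde{\mathrm{ad}}_T(U)=TU_0T^{-1}+\widehat{T}U_1T^{-1}$, where $U=U_0+U_1$, $U_0\in\mathcal{G}^{(0)}_{p,q,r}$, $U_1\in\mathcal{G}^{(1)}_{p,q,r}$, and $\ker(\tilde{\mathrm{ad}})=\{T\in\mathcal{G}^\times_{p,q,r}:\tilde{\mathrm{ad}}_T(U)=U\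 \forall U\in\mathcal{G}_{p,q,r}\}$. *)

theory Defs
  imports Complex_Main "HOL-Library.Set_Algebras"
begin

text \<open>
  The scalar field is \<open>\<real>\<close> or \<open>\<complex>\<close>, up to isomorphism. The constant \<open>neg_square\<close> is the
  diagonal entry of \<open>\<eta>\<close> at the positions \<open>p+1, \<dots>, p+q\<close>, the only place where the two cases
  differ: it is \<open>-1\<close> over \<open>\<real>\<close> and \<open>1\<close> over \<open>\<complex>\<close>.
\<close>

class real_or_complex = field +
  fixes neg_square :: 'a
  assumes real_or_complex:
    "(\<exists>\<phi> :: 'a \<Rightarrow> real. bij \<phi> \<and> (\<forall>x y. \<phi> (x + y) = \<phi> x + \<phi> y \<and> \<phi> (x * y) = \<phi> x * \<phi> y)
        \<and> neg_square = - 1)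
   \<or> (\<exists>\<phi> :: 'a \<Rightarrow> complex. bij \<phi> \<and> (\<forall>x y. \<phi> (x + y) = \<phi> x + \<phi> y \<and> \<phi> (x * y) = \<phi> x * \<phi> y)
        \<and> neg_square = 1)"

instantiation real :: real_or_complex
begin
definition neg_square_real :: real where "neg_square_real = - 1"
instance
  by standard (rule disjI1, rule exI[of _ "\<lambda>x. x"], simp add: neg_square_real_def bij_def)
end

instantiation complex :: real_or_complex
begin
definition neg_square_complex :: complex where "neg_square_complex = 1"
instance
  by standard (rule disjI2, rule exI[of _ "\<lambda>x. x"], simp add: neg_square_complex_def bij_def)
end

definition eta :: "nat \<Rightarrow> nat \<Rightarrow> nat \<Rightarrow> nat \<Rightarrow> nat \<Rightarrow> 'f::real_or_complex" where
  "eta p q r a b =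
     (if a \<noteq> b then 0 else if a \<le> p then 1 else if a \<le> p + q then neg_square else 0)"

definition invertible :: "'a::ring_1 \<Rightarrow> bool" where
  "invertible T \<longleftrightarrow> (\<exists>S. T * S = 1 \<and> S * T = 1)"

definition mult_inv :: "'a::ring_1 \<Rightarrow> 'a" where
  "mult_inv T = (THE S. T * S = 1 \<and> S * T = 1)"

definition units :: "'a::ring_1 set \<Rightarrow> 'a set" where
  "units A = {T \<in> A. invertible T}"

definition center :: "'a::ring_1 set" where
  "center = {Z. \<forall>U. Z * U = U * Z}"

locale unital_algebra = vector_space scale
  for scale :: "'f::field \<Rightarrow> 'a::ring_1 \<Rightarrow> 'a" (infixr \<open>*s\<close> 75) +
  assumes scale_mult_left: "(c *s x) * y = c *s (x * y)"
    and scale_mult_right: "x * (c *s y) = c *s (x * y)"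
begin

definition subalgebra :: "'a set \<Rightarrow> bool" where
  "subalgebra S \<longleftrightarrow> subspace S \<and> 1 \<in> S \<and> (\<forall>x\<in>S. \<forall>y\<in>S. x * y \<in> S)"

definition algebra_automorphism :: "('a \<Rightarrow> 'a) \<Rightarrow> bool" where
  "algebra_automorphism f \<longleftrightarrow>
     Vector_Spaces.linear scale scale f \<and> f 1 = 1 \<and> (\<forall>x y. f (x * y) = f x * f y) \<and> bij f"

end

text \<open>
  The whole type \<open>'a\<close> is the algebra \<open>\<G>\<^bsub>p,q,r\<^esub>\<close>; its identity is \<open>1\<close>, and its generators are
  \<open>e 1, \<dots>, e (p + q + r)\<close>. The values of \<open>e\<close> at other indices play no role.
\<close>

locale geometric_algebra = unital_algebra scale
  for scale :: "'f::real_or_complex \<Rightarrow> 'a::ring_1 \<Rightarrow> 'a" (infixr \<open>*s\<close> 75) +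
  fixes e :: "nat \<Rightarrow> 'a" and p q r :: nat
  assumes dimension: "dim (UNIV :: 'a set) = 2 ^ (p + q + r)"
    and generated: "subalgebra hull (e ` {1..p + q + r}) = UNIV"
    and relations: "\<lbrakk>a \<in> {1..p + q + r}; b \<in> {1..p + q + r}\<rbrakk> \<Longrightarrow>
      e a * e b + e b * e a = (2 * eta p q r a b) *s 1"
begin

abbreviation n :: nat where "n \<equiv> p + q + r"

text \<open>\<open>e\<^bsub>a\<^sub>1\<dots>a\<^sub>k\<^esub>\<close> for \<open>A = {a\<^sub>1 < \<dots> < a\<^sub>k}\<close>\<close>
definition blade :: "nat set \<Rightarrow> 'a" where
  "blade A = prod_list (map e (sorted_list_of_set A))"

definition grade :: "nat \<Rightarrow> 'a set" where
  "grade k = span {blade A | A. A \<subseteq> {1..n} \<and> card A = k}"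

definition grade_involution :: "'a \<Rightarrow> 'a" where
  "grade_involution = (THE f. algebra_automorphism f \<and> (\<forall>a\<in>{1..n}. f (e a) = - e a))"

definition parity :: "nat \<Rightarrow> 'a set" where
  "parity k = {U. grade_involution U = (- 1) ^ k * U}"

definition Grassmann :: "'a set" where
  "Grassmann = subalgebra hull (e ` {p + q + 1..n})"

text \<open>Below, \<open>*\<close> between sets is the set of products of their elements.\<close>

definition P_pm :: "'a set" where
  "P_pm = units (parity 0) \<union> units (parity 1)"

definition P :: "'a set" where
  "P = P_pm * units center"

definition P_pm_Lambda :: "'a set" where
  "P_pm_Lambda = P_pm * units Grassmann"

definition P_Lambda :: "'a set" where
  "P_Lambda = P * units Grassmann"

definition twisted_ad :: "'a \<Rightarrow> 'a \<Rightarrow> 'a" where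
  "twisted_ad T U = (THE W. \<exists>U\<^sub>0\<in>parity 0. \<exists>U\<^sub>1\<in>parity 1. U = U\<^sub>0 + U\<^sub>1 \<and>
     W = T * U\<^sub>0 * mult_inv T + grade_involution T * U\<^sub>1 * mult_inv T)"

definition ker_twisted_ad :: "'a set" where
  "ker_twisted_ad = {T \<in> units UNIV. \<forall>U. twisted_ad T U = U}"

end

end

theory Submission
  imports Defs
begin

text \<open>
  For invertible \<open>T\<close>, the condition \<open>hat T\<^sup>-\<^sup>1 \<cdot> T = M\<close> reads \<open>T = hat T \<cdot> M\<close>, equivalently
  \<open>hat T = T \<cdot> hat M\<close>. Hence \<open>T (hat M + 1) = hat T + T\<close> is even and \<open>T (hat M - 1) = hat T - T\<close> is
  odd, and \<open>T\<close> splits off a homogeneous invertible factor as soon as one of \<open>hat M \<plusminus> 1\<close> is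
  invertible. For \<open>M \<in> \<Lambda>\<close>, and for \<open>M \<in> \<Lambda> \<oplus> \<G>\<^sup>n\<close> with \<open>n\<close> odd, at least one of them is, because an
  element of \<open>\<Lambda>\<close> is invertible when its scalar part is nonzero. The volume element \<open>\<omega>\<close> annihilates
  the null generators, so that invertible elements of \<open>\<Lambda> \<oplus> \<G>\<^sup>n\<close> factor as \<open>(c + d\<omega>) l\<close> with
  \<open>l \<in> \<Lambda>\<close>; for \<open>n\<close> even and \<open>r \<noteq> n\<close>, the identity \<open>M \<cdot> hat M = 1\<close> forces \<open>M \<in> \<Lambda>\<close>.
\<close>

section \<open>Scalars: the characteristic is not two\<close>

lemma additive_bij_one_add_one:
  fixes \<phi> :: "'f::field \<Rightarrow> 'b::field_char_0"
  assumes "bij \<phi>" and add: "\<forall>x y. \<phi> (x + y) = \<phi> x + \<phi> y"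
  shows "(1::'f) + 1 \<noteq> 0"
proof
  assume two: "(1::'f) + 1 = 0"
  have "\<phi> 0 + \<phi> 0 = \<phi> 0"
    using add by (metis add_0)
  then have "\<phi> 0 = 0" by simp
  \<comment> \<open>Additivity transports \<open>1 + 1 = 0\<close> to the target, where
    characteristic zero then forces \<open>\<phi> 1 = 0\<close>.\<close>
  moreover have "\<phi> 1 + \<phi> 1 = \<phi> 0"
    using add two by metis
  ultimately have "\<phi> 1 = \<phi> 0" by (simp flip: mult_2)
  then show False
    using \<open>bij \<phi>\<close> by (metis bij_is_inj injD zero_neq_one)
qed

lemma two_neq_zero [simp]: "(2::'f::real_or_complex) \<noteq> 0"
proof
  assume "(2::'f) = 0"
  then have two: "(1::'f) + 1 = 0" by simp
  have "(\<exists>\<phi> :: 'f \<Rightarrow> real. bij \<phi> \<and> (\<forall>x y. \<phi> (x + y) = \<phi> x + \<phi> y)) \<or>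
      (\<exists>\<phi> :: 'f \<Rightarrow> complex. bij \<phi> \<and> (\<forall>x y. \<phi> (x + y) = \<phi> x + \<phi> y))"
    using real_or_complex[where ?'a = 'f] by blast
  with two show False
    using additive_bij_one_add_one by metis
qed

text \<open>The two scalars add up to \<open>2\<close>. With \<open>c\<close> the scalar part of the
  quotient \<open>M\<close>, this decides which of \<open>hat M + 1\<close> and
  \<open>hat M - 1\<close> gets inverted.\<close>

lemma one_add_or_one_diff_neq_zero: "1 + c \<noteq> 0 \<or> 1 - c \<noteq> (0::'f::real_or_complex)"
proof -
  have "(1 + c) + (1 - c) = 2" by simp
  then show ?thesis by (metis add_0_right two_neq_zero)
qed

lemma neg_square_neq_zero [simp]: "(neg_square::'f::real_or_complex) \<noteq> 0"
  using real_or_complex[where ?'a = 'f] by force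

section \<open>Inverses and units in a noncommutative ring\<close>

lemma invertible_inverse:
  assumes "invertible (x::'a::ring_1)"
  shows "x * mult_inv x = 1" and "mult_inv x * x = 1"
proof -
  obtain y where y: "x * y = 1" "y * x = 1"
    using assms by (auto simp: invertible_def)
  have "x * mult_inv x = 1 \<and> mult_inv x * x = 1"
    unfolding mult_inv_def
  proof (rule theI)
    show "x * y = 1 \<and> y * x = 1" using y by simp
    fix z assume "x * z = 1 \<and> z * x = 1"
    then show "z = y" using y by (metis mult.assoc mult.right_neutral mult.left_neutral)
  qed
  then show "x * mult_inv x = 1" and "mult_inv x * x = 1" by auto
qed

lemma mult_inv_cancel:
  assumes "invertible (x::'a::ring_1)"
  shows "x * (mult_inv x * y) = y" and "mult_inv x * (x * y) = y"
    and "y * mult_inv x * x = y" and "y * x * mult_inv x = y"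
  using invertible_inverse[OF assms]
  by (metis mult.assoc mult.left_neutral, metis mult.assoc mult.left_neutral,
      metis mult.assoc mult.right_neutral, metis mult.assoc mult.right_neutral)

lemma mult_inv_unique: "x * y = 1 \<Longrightarrow> y * x = 1 \<Longrightarrow> mult_inv x = (y::'a::ring_1)"
  by (metis invertible_def invertible_inverse(2) mult.assoc mult.left_neutral mult.right_neutral)

lemma invertible_one [simp]: "invertible (1::'a::ring_1)"
  by (auto simp: invertible_def)

lemma not_invertible_zero [simp]: "\<not> invertible (0::'a::ring_1)"
  by (auto simp: invertible_def)

lemma invertible_mult_inv [simp]: "invertible (x::'a::ring_1) \<Longrightarrow> invertible (mult_inv x)"
  using invertible_inverse[of x] by (auto simp: invertible_def)

lemma
  assumes "invertible (x::'a::ring_1)" "invertible y"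
  shows invertible_mult [simp]: "invertible (x * y)"
    and mult_inv_mult: "mult_inv (x * y) = mult_inv y * mult_inv x"
proof -
  have "x * y * (mult_inv y * mult_inv x) = 1" "mult_inv y * mult_inv x * (x * y) = 1"
    using invertible_inverse assms by (simp_all add: mult.assoc mult_inv_cancel)
  then show "invertible (x * y)" "mult_inv (x * y) = mult_inv y * mult_inv x"
    by (auto simp: invertible_def intro: mult_inv_unique)
qed

lemma invertible_cancel_left: "invertible (x::'a::ring_1) \<Longrightarrow> x * y = x * z \<Longrightarrow> y = z"
  by (metis mult_inv_cancel(2))

lemma invertible_cancel_right: "invertible (x::'a::ring_1) \<Longrightarrow> y * x = z * x \<Longrightarrow> y = z"
  by (metis mult_inv_cancel(4))

text \<open>If \<open>z\<close> inverts the product, then \<open>y * z\<close> is a right inverse of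
  \<open>x\<close> and, by commutation, \<open>z * y\<close> is a left inverse; the two must
  coincide.\<close>

lemma invertible_factor_left:
  assumes "invertible (x * y)" "x * y = y * (x::'a::ring_1)"
  shows "invertible x"
proof -
  define z where "z = mult_inv (x * y)"
  have r: "x * (y * z) = 1" and l: "(z * y) * x = 1"
    using invertible_inverse[OF assms(1)] assms(2) unfolding z_def by (metis mult.assoc)+
  moreover have "y * z = z * y"
    using r l by (metis mult.assoc mult.left_neutral mult.right_neutral)
  ultimately show ?thesis
    unfolding invertible_def by metis
qed

lemma units_mono: "A \<subseteq> B \<Longrightarrow> units A \<subseteq> units B"
  by (auto simp: units_def)

lemma units_times_units:
  assumes "\<And>x y. x \<in> A \<Longrightarrow> y \<in> A \<Longrightarrow> x * y \<in> (A::'a::ring_1 set)" "1 \<in> A"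
  shows "units A * units A = units A"
proof
  show "units A * units A \<subseteq> units A"
    using assms(1) by (auto simp: set_times_def units_def)
  show "units A \<subseteq> units A * units A"
    using assms(2) by (force simp: set_times_def units_def)
qed

section \<open>Subalgebras and induction over their hulls\<close>

context unital_algebra
begin

lemma subalgebra_hull: "subalgebra (subalgebra hull S)"
  by (rule hull_in) (auto simp: subalgebra_def intro: subspace_Inter)

lemma
  assumes "subalgebra S"
  shows subalgebra_one: "1 \<in> S"
    and subalgebra_zero: "0 \<in> S"
    and subalgebra_add: "x \<in> S \<Longrightarrow> y \<in> S \<Longrightarrow> x + y \<in> S"
    and subalgebra_diff: "x \<in> S \<Longrightarrow> y \<in> S \<Longrightarrow> x - y \<in> S"
    and subalgebra_mult: "x \<in> S \<Longrightarrow> y \<in> S \<Longrightarrow> x * y \<in> S"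
    and subalgebra_scale: "x \<in> S \<Longrightarrow> c *s x \<in> S"
    and subalgebra_sum: "(\<And>i. i \<in> I \<Longrightarrow> f i \<in> S) \<Longrightarrow> sum f I \<in> S"
  using assms unfolding subalgebra_def
  by (auto intro: subspace_0 subspace_add subspace_diff subspace_scale subspace_sum)

lemma subalgebra_hull_induct [consumes 1, case_names generator one add scale mult]:
  assumes "x \<in> subalgebra hull S"
    and "\<And>x. x \<in> S \<Longrightarrow> Q x"
    and "Q 1"
    and "\<And>x y. Q x \<Longrightarrow> Q y \<Longrightarrow> Q (x + y)"
    and "\<And>c x. Q x \<Longrightarrow> Q (c *s x)"
    and "\<And>x y. Q x \<Longrightarrow> Q y \<Longrightarrow> Q (x * y)"
  shows "Q x"
proof -
  \<comment> \<open>\<open>0\<close> is reached as the multiple \<open>0 *s 1\<close>.\<close>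
  have "Q 0" using assms(3) assms(5)[of 1 0] by simp
  then have "subalgebra {x. Q x}"
    unfolding subalgebra_def subspace_def using assms(3-6) by auto
  then have "subalgebra hull S \<subseteq> {x. Q x}"
    using assms(2) by (intro hull_minimal) auto
  then show ?thesis using assms(1) by auto
qed

lemma invertible_scale:
  assumes "c \<noteq> 0" "invertible x"
  shows "invertible (c *s x)"
  unfolding invertible_def
  by (rule exI[of _ "inverse c *s mult_inv x"])
    (use assms in \<open>simp add: scale_mult_left scale_mult_right invertible_inverse\<close>)

end

context geometric_algebra
begin

subsection \<open>The basis of blades\<close>

lemma generated_induct [case_names generator one add scale mult]:
  assumes "\<And>a. a \<in> {1..n} \<Longrightarrow> Q (e a)"
    and "Q 1"
    and "\<And>x y. Q x \<Longrightarrow> Q y \<Longrightarrow> Q (x + y)"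
    and "\<And>c x. Q x \<Longrightarrow> Q (c *s x)"
    and "\<And>x y. Q x \<Longrightarrow> Q y \<Longrightarrow> Q (x * y)"
  shows "Q x"
proof -
  have "x \<in> subalgebra hull (e ` {1..n})" using generated by simp
  then show ?thesis by (induction rule: subalgebra_hull_induct) (use assms in auto)
qed

lemma generator_square:
  assumes "a \<in> {1..n}"
  shows "e a * e a = eta p q r a a *s 1"
proof -
  have "2 *s (e a * e a) = 2 *s (eta p q r a a *s 1)"
    using relations[OF assms assms] by (simp add: scale_left_distrib[of 1 1, simplified])
  then show ?thesis by (metis scale_cancel_left two_neq_zero)
qed

lemma generators_anticommute:
  assumes "a \<in> {1..n}" "b \<in> {1..n}" "a \<noteq> b"
  shows "e a * e b = - (e b * e a)"
  using relations[OF assms(1,2)] assms(3) by (simp add: eta_def add_eq_0_iff)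

lemma blade_empty [simp]: "blade {} = 1"
  by (simp add: blade_def)

text \<open>The recursion for ordered products: the sorted list starts with its least index. This is
  why the inductions on blades below remove the minimum.\<close>

lemma blade_insert_min:
  assumes "finite A" "\<forall>a\<in>A. b < a"
  shows "blade (insert b A) = e b * blade A"
proof -
  have "sorted_list_of_set (insert b A) = b # sorted_list_of_set A"
    using assms by (subst sorted_list_of_set_insert) (auto intro: insort_is_Cons simp: less_imp_le)
  then show ?thesis by (simp add: blade_def)
qed

lemma blade_singleton [simp]: "blade {a} = e a"
  using blade_insert_min[of "{}" a] by simp


text \<open>The sign picked up when \<open>e a\<close> crosses \<open>blade A\<close>: one factor
  \<open>-1\<close> for each index other than \<open>a\<close>. Negating the power replaces the
  exponent \<open>card A - 1\<close> and so avoids truncated subtraction.\<close>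

definition reorder_sign :: "nat \<Rightarrow> nat set \<Rightarrow> 'f" where
  "reorder_sign a A = (if a \<in> A then - ((- 1) ^ card A) else (- 1) ^ card A)"

lemma reorder_sign_square [simp]: "reorder_sign a A * reorder_sign a A = 1"
  by (simp add: reorder_sign_def flip: power_mult_distrib)

lemma generator_mult_blade:
  assumes "a \<in> {1..n}" "A \<subseteq> {1..n}"
  shows "e a * blade A = reorder_sign a A *s (blade A * e a)"
proof -
  have "finite A" using assms(2) by (rule finite_subset) simp
  then show ?thesis using assms(2)
  proof (induction A rule: finite_linorder_min_induct)
    case empty
    then show ?case by (simp add: reorder_sign_def)
  next
    case (insert b A)
    have "b \<notin> A" using insert.hyps by auto
    have IH: "e a * blade A = reorder_sign a A *s (blade A * e a)"
      using insert by auto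
    show ?case
    proof (cases "a = b")
      case True
      then have "e a * blade (insert b A) = e b * (e b * blade A)"
        using insert.hyps by (simp add: blade_insert_min)
      also have "\<dots> = reorder_sign a A *s (e b * blade A * e b)"
        using IH unfolding True by (metis mult.assoc scale_mult_right)
      also have "reorder_sign a A = reorder_sign a (insert b A)"
        using True insert.hyps \<open>b \<notin> A\<close> by (simp add: reorder_sign_def)
      finally show ?thesis
        using True insert.hyps by (simp add: blade_insert_min)
    next
      case False
      have "e a * blade (insert b A) = e a * e b * blade A"
        using insert.hyps by (simp add: blade_insert_min mult.assoc)
      also have "\<dots> = - (e b * (e a * blade A))"
        using generators_anticommute[of a b] False assms(1) insert.prems by (simp add: mult.assoc)
      also have "\<dots> = - reorder_sign a A *s (e b * blade A * e a)"
        unfolding IH by (simp add: scale_mult_right mult.assoc)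
      also have "- reorder_sign a A = reorder_sign a (insert b A)"
        using False insert.hyps \<open>b \<notin> A\<close> by (simp add: reorder_sign_def)
      finally show ?thesis
        using insert.hyps by (simp add: blade_insert_min)
    qed
  qed
qed

lemma eta_eq_zero_iff: "eta p q r a a = (0::'f) \<longleftrightarrow> p + q < a"
  by (auto simp: eta_def)

text \<open>The factor \<open>e a\<close> moves, up to sign, to its sorted place. There it either
  joins the blade or meets its own copy and contracts to the scalar \<open>eta p q r a a\<close>,
  which is zero exactly for null generators. So multiplication toggles \<open>a\<close> in the index
  set.\<close>

lemma generator_mult_blade_symdiff:
  assumes "a \<in> {1..n}" "A \<subseteq> {1..n}"
  obtains c where "e a * blade A = c *s blade (sym_diff A {a})"
    and "c = 0 \<longleftrightarrow> a \<in> A \<and> p + q < a"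
proof -
  have "finite A" using assms(2) by (rule finite_subset) simp
  then have "\<exists>c. e a * blade A = c *s blade (sym_diff A {a}) \<and> (c = 0 \<longleftrightarrow> a \<in> A \<and> p + q < a)"
    using assms
  proof (induction A rule: finite_linorder_min_induct)
    case empty
    then show ?case by (intro exI[of _ 1]) simp
  next
    case (insert b A)
    have "b \<notin> A" using insert.hyps by auto
    consider "a < b" | "a = b" | "b < a" by linarith
    then show ?case
    proof cases
      case 1
      then have lt: "\<forall>x\<in>insert b A. a < x" using insert.hyps by auto
      then have "a \<notin> insert b A" by blast
      moreover have "e a * blade (insert b A) = blade (insert a (insert b A))"
        using insert.hyps lt by (simp add: blade_insert_min)
      ultimately show ?thesis
        by (intro exI[of _ 1]) (simp add: insert_commute)
    next
      case 2
      have "e a * blade (insert b A) = eta p q r a a *s blade A"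
        using 2 insert.hyps insert.prems generator_square[of a]
        by (simp add: blade_insert_min scale_mult_left flip: mult.assoc)
      moreover have "sym_diff (insert b A) {a} = A"
        using 2 \<open>b \<notin> A\<close> by auto
      ultimately show ?thesis
        using 2 by (intro exI[of _ "eta p q r a a"]) (simp add: eta_eq_zero_iff)
    next
      case 3
      obtain c where c: "e a * blade A = c *s blade (sym_diff A {a})"
        "c = 0 \<longleftrightarrow> a \<in> A \<and> p + q < a"
        using insert by auto
      have "e a * blade (insert b A) = e a * e b * blade A"
        using insert.hyps by (simp add: blade_insert_min mult.assoc)
      also have "\<dots> = - (e b * (e a * blade A))"
        using generators_anticommute[of a b] 3 insert.prems by (simp add: mult.assoc)
      also have "\<dots> = - c *s (e b * blade (sym_diff A {a}))"
        unfolding c(1) by (simp add: scale_mult_right)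
      also have "e b * blade (sym_diff A {a}) = blade (insert b (sym_diff A {a}))"
        using insert.hyps 3 by (subst blade_insert_min) auto
      also have "insert b (sym_diff A {a}) = sym_diff (insert b A) {a}"
        using 3 by auto
      finally show ?thesis
        using c(2) 3 by (intro exI[of _ "- c"]) auto
    qed
  qed
  then show thesis using that by blast
qed

lemma generator_mult_blade_span:
  assumes "a \<in> {1..n}" "A \<subseteq> {1..n}"
  shows "e a * blade A \<in> span (blade ` Pow {1..n})"
proof -
  obtain c where "e a * blade A = c *s blade (sym_diff A {a})"
    using generator_mult_blade_symdiff[OF assms] by metis
  moreover have "sym_diff A {a} \<in> Pow {1..n}" using assms by auto
  ultimately show ?thesis by (metis imageI span_base span_scale)
qed

text \<open>The span is closed under left multiplication by generators, hence by every element, and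
  it contains \<open>1\<close>.\<close>

lemma span_blades: "span (blade ` Pow {1..n}) = UNIV"
proof -
  let ?V = "span (blade ` Pow {1..n})"
  have gen: "e a * y \<in> ?V" if a: "a \<in> {1..n}" and "y \<in> ?V" for a y
    using \<open>y \<in> ?V\<close>
  proof (induction rule: span_induct_alt)
    case base
    then show ?case by (simp add: span_zero)
  next
    case (step c x y)
    then show ?case
      using generator_mult_blade_span[OF a]
      by (auto simp: distrib_left scale_mult_right intro!: span_add span_scale)
  qed
  have mult: "\<forall>y\<in>?V. x * y \<in> ?V" for x
  proof (induction x rule: generated_induct)
    case (generator a)
    then show ?case using gen by blast
  qed (auto simp: distrib_right scale_mult_left mult.assoc intro: span_add span_scale)
  have "blade {} \<in> ?V" by (intro span_base imageI) simp
  then have "x \<in> ?V" for x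
    using mult[of x] by (metis blade_empty mult.right_neutral)
  then show ?thesis by auto
qed

lemma blades_basis: "independent (blade ` Pow {1..n})" "inj_on blade (Pow {1..n})"
proof -
  let ?B = "blade ` Pow {1..n}"
  obtain B where B: "B \<subseteq> ?B" "independent B" "?B \<subseteq> span B"
    using maximal_independent_subset[of ?B] by blast
  have "span B = UNIV"
    using B(3) span_blades by (metis span_mono span_span top.extremum_uniqueI)
  then have "card B = 2 ^ n"
    using B(2) basis_card_eq_dim[of B UNIV] dimension by simp
  moreover have "card ?B \<le> 2 ^ n"
    using card_image_le[of "Pow {1..n}" blade] by (simp add: card_Pow)
  ultimately have "B = ?B"
    using B(1) by (intro card_seteq) auto
  with B(2) show "independent ?B" by simp
  from \<open>B = ?B\<close> \<open>card B = 2 ^ n\<close> show "inj_on blade (Pow {1..n})"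
    by (intro eq_card_imp_inj_on) (auto simp: card_Pow)
qed

text \<open>Independence concerns sets of vectors; injectivity of \<open>blade\<close> allows the
  coefficients to be indexed by index sets instead.\<close>

lemma blade_combination_zero:
  assumes "(\<Sum>A\<in>Pow {1..n}. t A *s blade A) = 0" "A \<subseteq> {1..n}"
  shows "t A = 0"
proof -
  let ?P = "Pow {1..n}"
  define u where "u v = t (the_inv_into ?P blade v)" for v
  have u: "u (blade B) = t B" if "B \<in> ?P" for B
    using the_inv_into_f_f[OF blades_basis(2) that] by (simp add: u_def)
  have "(\<Sum>v\<in>blade ` ?P. u v *s v) = 0"
    unfolding sum.reindex[OF blades_basis(2)] o_def using assms(1) u by simp
  then have "u (blade A) = 0"
    using assms(2) by (intro independentD[OF blades_basis(1), of "blade ` ?P"]) auto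
  then show ?thesis using u assms(2) by simp
qed

lemma blade_expansion:
  obtains t where "x = (\<Sum>A\<in>Pow {1..n}. t A *s blade A)"
proof -
  have "x \<in> span (blade ` Pow {1..n})" using span_blades by simp
  then obtain u where "x = (\<Sum>v\<in>blade ` Pow {1..n}. u v *s v)"
    by (subst (asm) span_finite) auto
  then show thesis
    unfolding sum.reindex[OF blades_basis(2)] o_def by (rule that)
qed

lemma blade_neq_zero: "A \<subseteq> {1..n} \<Longrightarrow> blade A \<noteq> 0"
  using blades_basis(1) dependent_zero by (metis Pow_iff imageI)

lemma blade_scale_eq_imp_zero:
  assumes "A \<subseteq> {1..n}" "B \<subseteq> {1..n}" "A \<noteq> B" "c *s blade A = d *s blade B"
  shows "c = 0"
proof -
  define t where "t = (\<lambda>X. if X = A then c else if X = B then - d else 0)"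
  have "(\<Sum>X\<in>Pow {1..n}. t X *s blade X) = (\<Sum>X\<in>{A, B}. t X *s blade X)"
    using assms by (intro sum.mono_neutral_right) (auto simp: t_def)
  also have "\<dots> = 0" using assms by (simp add: t_def)
  finally have "(\<Sum>X\<in>Pow {1..n}. t X *s blade X) = 0" .
  from blade_combination_zero[OF this assms(1)] show "c = 0" by (simp add: t_def)
qed

text \<open>Toggling \<open>a\<close> permutes the index sets, so the sum is again a combination of
  distinct blades, and \<open>t A\<close> appears at \<open>sym_diff A {a}\<close> with a factor
  that the last hypothesis keeps nonzero. This reads off coefficients from commutation
  relations.\<close>

lemma generator_mult_combination_zero:
  assumes "(\<Sum>A\<in>Pow {1..n}. t A *s (e a * blade A)) = 0" "a \<in> {1..n}" "A \<subseteq> {1..n}"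
    and "\<not> (a \<in> A \<and> p + q < a)"
  shows "t A = 0"
proof -
  let ?P = "Pow {1..n}" and ?s = "\<lambda>A. sym_diff A {a}"
  have "\<exists>c. \<forall>A\<in>?P. e a * blade A = c A *s blade (?s A) \<and> (c A = 0 \<longleftrightarrow> a \<in> A \<and> p + q < a)"
    using generator_mult_blade_symdiff[OF assms(2)] by (intro bchoice) (metis Pow_iff)
  then obtain c where c: "\<And>A. A \<in> ?P \<Longrightarrow> e a * blade A = c A *s blade (?s A)"
    "\<And>A. A \<in> ?P \<Longrightarrow> c A = 0 \<longleftrightarrow> a \<in> A \<and> p + q < a" by blast
  have s: "?s (?s A) = A" "A \<in> ?P \<Longrightarrow> ?s A \<in> ?P" for A
    using assms(2) by auto
  have "(\<Sum>A\<in>?P. (t (?s A) * c (?s A)) *s blade A) = (\<Sum>A\<in>?P. t A *s (e a * blade A))"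
    by (rule sum.reindex_bij_witness[of _ ?s ?s]) (simp_all only: s c(1), simp add: s)
  then have "t (?s (?s A)) * c (?s (?s A)) = 0"
    using blade_combination_zero[of "\<lambda>A. t (?s A) * c (?s A)" "?s A"] assms s(2)[of A] by simp
  then show ?thesis
    using c(2)[of A] assms by (simp add: s(1))
qed

subsection \<open>The grade involution\<close>

lemma linear_iff_scale:
  "Vector_Spaces.linear scale scale f \<longleftrightarrow>
    (\<forall>x y. f (x + y) = f x + f y) \<and> (\<forall>c x. f (c *s x) = c *s f x)"
  using vector_space_axioms
  by (auto simp: Vector_Spaces.linear_def module_hom_def module_hom_axioms_def
      module_iff_vector_space)

lemma grade_involution_unique:
  assumes f: "algebra_automorphism f" "\<forall>a\<in>{1..n}. f (e a) = - e a"
    and g: "algebra_automorphism g" "\<forall>a\<in>{1..n}. g (e a) = - e a"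
  shows "f = g"
proof
  fix x
  show "f x = g x"
    by (induction x rule: generated_induct)
      (use f g in \<open>simp_all add: algebra_automorphism_def linear_iff_scale\<close>)
qed

text \<open>The map is defined linearly on the basis by the sign \<open>(- 1) ^ card A\<close>.
  Multiplicativity is first checked for a generator times a blade and then spreads by induction on
  the left factor.\<close>

lemma grade_involution_exists:
  obtains f where "algebra_automorphism f" "\<forall>a\<in>{1..n}. f (e a) = - e a"
proof -
  let ?P = "Pow {1..n}"
  interpret pair: vector_space_pair scale scale ..
  define s where "s v = (- 1) ^ card (the_inv_into ?P blade v) *s v" for v
  obtain f where f: "Vector_Spaces.linear scale scale f" "\<And>v. v \<in> blade ` ?P \<Longrightarrow> f v = s v"
    using pair.linear_independent_extend[OF blades_basis(1), of s] by blast
  have f_blade: "f (blade A) = (- 1) ^ card A *s blade A" if "A \<subseteq> {1..n}" for A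
    using f(2)[of "blade A"] the_inv_into_f_f[OF blades_basis(2)] that by (auto simp: s_def)
  have add: "f (x + y) = f x + f y" and scale: "f (c *s x) = c *s f x" for x y c
    using f(1) by (auto simp: linear_iff_scale)
  have zero: "f 0 = 0" using scale[of 0 0] by simp
  have one: "f 1 = 1" using f_blade[of "{}"] by simp
  have sum: "f (\<Sum>i\<in>I. h i) = (\<Sum>i\<in>I. f (h i))" for I and h :: "nat set \<Rightarrow> 'a"
    by (induction I rule: infinite_finite_induct) (simp_all add: zero add)
  have gen_blade: "f (e a * blade A) = - (e a * f (blade A))"
    if a: "a \<in> {1..n}" and A: "A \<subseteq> {1..n}" for a A
  proof -
    obtain c where c: "e a * blade A = c *s blade (sym_diff A {a})"
      using generator_mult_blade_symdiff[OF a A] by metis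
    have "finite A" using A by (rule finite_subset) simp
    \<comment> \<open>Toggling one index changes the parity of the cardinality, which produces the
      minus sign of \<open>f (e a)\<close>.\<close>
    have "card (sym_diff A {a}) = Suc (card A) \<or> card A = Suc (card (sym_diff A {a}))"
    proof (cases "a \<in> A")
      case True
      then have "sym_diff A {a} = A - {a}" by auto
      then show ?thesis using card_Suc_Diff1[OF \<open>finite A\<close> True] by simp
    next
      case False
      then have "sym_diff A {a} = insert a A" by auto
      then show ?thesis using False \<open>finite A\<close> by simp
    qed
    then have sign: "(- 1 :: 'f) ^ card (sym_diff A {a}) = - ((- 1) ^ card A)" by auto
    have "sym_diff A {a} \<subseteq> {1..n}" using a A by auto
    then have "f (e a * blade A) = - ((- 1) ^ card A) *s (c *s blade (sym_diff A {a}))"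
      using f_blade[of "sym_diff A {a}"] unfolding c scale sign by (simp add: mult.commute)
    also have "\<dots> = - (e a * f (blade A))"
      using f_blade[OF A] by (simp add: scale_mult_right c)
    finally show ?thesis .
  qed
  have gen: "f (e a * x) = - (e a * f x)" if "a \<in> {1..n}" for a x
  proof -
    obtain t where x: "x = (\<Sum>A\<in>?P. t A *s blade A)" by (rule blade_expansion)
    show ?thesis
      unfolding x sum_distrib_left scale_mult_right sum scale
      using gen_blade[OF that] by (simp add: sum_negf scale_mult_right)
  qed
  have mult: "\<forall>y. f (x * y) = f x * f y" for x
  proof (induction x rule: generated_induct)
    case (generator a)
    then show ?case using gen[of a] gen[of a 1] one by simp
  qed (simp_all add: one add scale distrib_right scale_mult_left mult.assoc)
  have e: "f (e a) = - e a" if "a \<in> {1..n}" for a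
    using gen[OF that, of 1] one by simp
  have minus: "f (- x) = - f x" for x
    using scale[of "- 1" x] by simp
  \<comment> \<open>Being its own inverse makes \<open>f\<close> bijective.\<close>
  have "f (f x) = x" for x
    by (induction x rule: generated_induct) (simp_all add: e minus add scale mult one)
  then have "bij f" by (rule involuntory_imp_bij)
  then have "algebra_automorphism f"
    using f(1) mult one by (simp add: algebra_automorphism_def)
  with e show thesis using that by blast
qed

abbreviation hat :: "'a \<Rightarrow> 'a" where "hat \<equiv> grade_involution"

lemma hat_automorphism: "algebra_automorphism hat"
  and hat_generator: "a \<in> {1..n} \<Longrightarrow> hat (e a) = - e a"
proof -
  obtain f where f: "algebra_automorphism f" "\<forall>a\<in>{1..n}. f (e a) = - e a"
    by (rule grade_involution_exists)
  have "hat = f"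
    unfolding grade_involution_def using f grade_involution_unique by (intro the_equality) blast+
  with f show "algebra_automorphism hat" "a \<in> {1..n} \<Longrightarrow> hat (e a) = - e a" by auto
qed

lemma hat_add [simp]: "hat (x + y) = hat x + hat y"
  and hat_scale [simp]: "hat (c *s x) = c *s hat x"
  and hat_mult [simp]: "hat (x * y) = hat x * hat y"
  and hat_one [simp]: "hat 1 = 1"
  using hat_automorphism by (auto simp: algebra_automorphism_def linear_iff_scale)

lemma hat_minus [simp]: "hat (- x) = - hat x"
  using hat_scale[of "- 1" x] by simp

lemma hat_diff [simp]: "hat (x - y) = hat x - hat y"
  using hat_add[of x "- y"] by simp

lemma hat_zero [simp]: "hat 0 = 0"
  using hat_scale[of 0 0] by simp

lemma hat_sum [simp]: "hat (\<Sum>i\<in>I. f i) = (\<Sum>i\<in>I. hat (f i))"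
  by (induction I rule: infinite_finite_induct) simp_all

lemma hat_hat [simp]: "hat (hat x) = x"
  by (induction x rule: generated_induct) (simp_all add: hat_generator)

lemma hat_blade:
  assumes "A \<subseteq> {1..n}"
  shows "hat (blade A) = (- 1) ^ card A *s blade A"
proof -
  have "finite A" using assms by (rule finite_subset) simp
  then show ?thesis using assms
  proof (induction A rule: finite_linorder_min_induct)
    case (insert b A)
    moreover have "b \<notin> A" using insert.hyps by auto
    ultimately show ?case
      by (simp add: blade_insert_min hat_generator scale_mult_right)
  qed simp
qed

lemma
  assumes "invertible x"
  shows invertible_hat [simp]: "invertible (hat x)"
    and hat_mult_inv: "hat (mult_inv x) = mult_inv (hat x)"
proof -
  have "hat x * hat (mult_inv x) = 1" "hat (mult_inv x) * hat x = 1"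
    using invertible_inverse[OF assms] by (simp_all flip: hat_mult)
  then show "invertible (hat x)" "hat (mult_inv x) = mult_inv (hat x)"
    by (auto simp: invertible_def dest: mult_inv_unique)
qed

lemma parity_zero: "x \<in> parity 0 \<longleftrightarrow> hat x = x"
  and parity_one: "x \<in> parity 1 \<longleftrightarrow> hat x = - x"
  by (simp_all add: parity_def)

section \<open>Even and odd parts, and the value of the twisted adjoint representation\<close>

lemma scale_half_double [simp]: "(1 / 2) *s (x + x) = x"
  using scale_left_distrib[of "1/2" "1/2" x] by (simp add: scale_right_distrib flip: add_divide_distrib)

lemma parity_decomposition_unique:
  assumes "U = U\<^sub>0 + U\<^sub>1" "U\<^sub>0 \<in> parity 0" "U\<^sub>1 \<in> parity 1"
  shows "U\<^sub>0 = (1 / 2) *s (U + hat U)" "U\<^sub>1 = (1 / 2) *s (U - hat U)"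
  using assms by (simp_all add: parity_zero parity_one[unfolded One_nat_def])

lemma parity_decomposition:
  "U = (1 / 2) *s (U + hat U) + (1 / 2) *s (U - hat U)"
  "(1 / 2) *s (U + hat U) \<in> parity 0" "(1 / 2) *s (U - hat U) \<in> parity 1"
proof -
  have "(1 / 2) *s (U + hat U) + (1 / 2) *s (U - hat U) = (1 / 2) *s (U + U)"
    unfolding scale_right_distrib[symmetric] by simp
  then show "U = (1 / 2) *s (U + hat U) + (1 / 2) *s (U - hat U)" by simp
qed (simp_all add: parity_def add.commute flip: scale_minus_right)

text \<open>Uniqueness of the even and odd parts makes the definite description in
  \<open>twisted_ad\<close> pick out this value.\<close>

lemma twisted_ad_eq:
  "twisted_ad T ((U\<^sub>0::'a) + U\<^sub>1) = T * U\<^sub>0 * mult_inv T + hat T * U\<^sub>1 * mult_inv T"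
  if "U\<^sub>0 \<in> parity 0" "U\<^sub>1 \<in> parity 1"
  unfolding twisted_ad_def
proof (rule the_equality)
  fix W assume "\<exists>V\<^sub>0\<in>parity 0. \<exists>V\<^sub>1\<in>parity 1. U\<^sub>0 + U\<^sub>1 = V\<^sub>0 + V\<^sub>1 \<and>
     W = T * V\<^sub>0 * mult_inv T + hat T * V\<^sub>1 * mult_inv T"
  then obtain V\<^sub>0 V\<^sub>1 where V: "V\<^sub>0 \<in> parity 0" "V\<^sub>1 \<in> parity 1" "U\<^sub>0 + U\<^sub>1 = V\<^sub>0 + V\<^sub>1"
    "W = T * V\<^sub>0 * mult_inv T + hat T * V\<^sub>1 * mult_inv T" by blast
  moreover have "V\<^sub>0 = U\<^sub>0" "V\<^sub>1 = U\<^sub>1"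
    using parity_decomposition_unique[OF V(3,1,2)] parity_decomposition_unique[OF refl that] by simp_all
  ultimately show "W = T * U\<^sub>0 * mult_inv T + hat T * U\<^sub>1 * mult_inv T" by simp
qed (use that in blast)

subsection \<open>The Grassmann subalgebra\<close>

lemma Grassmann_subalgebra: "subalgebra Grassmann"
  unfolding Grassmann_def by (rule subalgebra_hull)

lemmas Grassmann_zero [simp] = subalgebra_zero[OF Grassmann_subalgebra]
  and Grassmann_one [simp] = subalgebra_one[OF Grassmann_subalgebra]
  and Grassmann_add = subalgebra_add[OF Grassmann_subalgebra]
  and Grassmann_diff = subalgebra_diff[OF Grassmann_subalgebra]
  and Grassmann_mult = subalgebra_mult[OF Grassmann_subalgebra]
  and Grassmann_scale = subalgebra_scale[OF Grassmann_subalgebra]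
  and Grassmann_sum = subalgebra_sum[OF Grassmann_subalgebra]

lemma Grassmann_generator: "a \<in> {p + q + 1..n} \<Longrightarrow> e a \<in> Grassmann"
  unfolding Grassmann_def by (intro hull_inc imageI)

text \<open>A null generator anticommutes with every generator, also with itself, since its square
  is zero. The relation then passes to sums and products because \<open>hat\<close> is
  multiplicative.\<close>

lemma Grassmann_twisted_commute:
  assumes "x \<in> Grassmann" "a \<in> {1..n}"
  shows "e a * x = hat x * e a"
  using assms(1) unfolding Grassmann_def
proof (induction rule: subalgebra_hull_induct)
  case (generator x)
  then obtain b where b: "b \<in> {p + q + 1..n}" "x = e b" by auto
  then have "e a * e b = - (e b * e a)"
    using assms(2) generators_anticommute[of a b] generator_square[of a]
    by (cases "a = b") (auto simp: eta_def)
  with b show ?case by (simp add: hat_generator)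
next
  case (mult x y)
  then show ?case by simp (metis mult.assoc)
qed (simp_all add: distrib_left distrib_right scale_mult_left scale_mult_right)

lemma Grassmann_blade:
  assumes "A \<subseteq> {p + q + 1..n}"
  shows "blade A \<in> Grassmann"
proof -
  have "finite A" using assms by (rule finite_subset) simp
  then show ?thesis using assms
    by (induction A rule: finite_linorder_min_induct)
      (auto simp: blade_insert_min intro!: Grassmann_mult Grassmann_generator)
qed

text \<open>Comparing coefficients of \<open>e a * x\<close> and \<open>hat x * e a\<close> kills
  every blade that contains an index \<open>a \<le> p + q\<close>, so only blades in null generators
  remain. Together with the previous relation this characterizes \<Lambda> by twisted
  commutation.\<close>

lemma twisted_commute_imp_Grassmann:
  assumes "\<And>a. a \<in> {1..n} \<Longrightarrow> e a * x = hat x * e a"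
  shows "x \<in> Grassmann"
proof -
  obtain t where x: "x = (\<Sum>A\<in>Pow {1..n}. t A *s blade A)" by (rule blade_expansion)
  have t: "t A = 0" if A: "A \<subseteq> {1..n}" "a \<in> A" "a \<le> p + q" for a A
  proof -
    have a: "a \<in> {1..n}" using A by auto
    have hat: "hat (blade B) * e a = ((- 1) ^ card B * reorder_sign a B) *s (e a * blade B)"
      if "B \<subseteq> {1..n}" for B
      using generator_mult_blade[OF a that] hat_blade[OF that]
      by (simp add: scale_mult_left mult.assoc)
    have "(\<Sum>B\<in>Pow {1..n}. (t B * (1 - (- 1) ^ card B * reorder_sign a B)) *s (e a * blade B))
        = e a * x - hat x * e a"
      unfolding x hat_sum hat_scale sum_distrib_left sum_distrib_right
        scale_mult_left scale_mult_right sum_subtractf[symmetric]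
      by (intro sum.cong refl)
        (simp add: hat scale_left_diff_distrib right_diff_distrib)
    also have "\<dots> = 0" using assms[OF a] by simp
    finally have "t A * (1 - (- 1) ^ card A * reorder_sign a A) = 0"
      using A(3) by (intro generator_mult_combination_zero[OF _ a A(1)]) auto
    \<comment> \<open>For \<open>a \<in> A\<close> the grading sign and the reordering sign are
      opposite, so their product is \<open>-1\<close>.\<close>
    moreover have "1 - (- 1) ^ card A * reorder_sign a A = (2::'f)"
      using A by (simp add: reorder_sign_def flip: power_mult_distrib)
    ultimately show ?thesis by simp
  qed
  have "t A *s blade A \<in> Grassmann" if "A \<subseteq> {1..n}" for A
  proof (cases "A \<subseteq> {p + q + 1..n}")
    case True
    then show ?thesis by (intro Grassmann_scale Grassmann_blade)
  next
    case False
    then obtain a where "a \<in> A" "a \<notin> {p + q + 1..n}" by blast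
    with that have "t A = 0" by (intro t[of A a]) auto
    then show ?thesis by simp
  qed
  then show ?thesis unfolding x by (intro Grassmann_sum) auto
qed

lemma Grassmann_hat [simp]: "hat x \<in> Grassmann \<longleftrightarrow> x \<in> Grassmann"
proof -
  have "hat x \<in> Grassmann" if "x \<in> Grassmann" for x
  proof (rule twisted_commute_imp_Grassmann)
    fix a assume a: "a \<in> {1..n}"
    have "hat (e a * x) = hat (hat x * e a)"
      using Grassmann_twisted_commute[OF that a] by simp
    then show "e a * hat x = hat (hat x) * e a" using a by (simp add: hat_generator)
  qed
  then show ?thesis by (metis hat_hat)
qed

lemma Grassmann_twisted_commute':
  assumes "x \<in> Grassmann" "a \<in> {1..n}"
  shows "x * e a = e a * hat x"
  using Grassmann_twisted_commute[of "hat x" a] assms by simp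

text \<open>Multiplying \<open>e a * x = hat x * e a\<close> by the inverse of \<open>hat x\<close>
  on the left and of \<open>x\<close> on the right gives the same relation for the inverse.\<close>

lemma Grassmann_mult_inv:
  assumes "x \<in> Grassmann" "invertible x"
  shows "mult_inv x \<in> Grassmann"
proof (rule twisted_commute_imp_Grassmann)
  fix a assume a: "a \<in> {1..n}"
  let ?y = "mult_inv x"
  have "hat ?y * e a = hat ?y * (e a * x) * ?y"
    using assms(2) by (simp add: mult.assoc invertible_inverse)
  also have "\<dots> = mult_inv (hat x) * (hat x * e a) * ?y"
    using Grassmann_twisted_commute[OF assms(1) a] assms(2) by (simp add: hat_mult_inv)
  also have "\<dots> = e a * ?y"
    using assms(2) by (simp add: mult_inv_cancel)
  finally show "e a * ?y = hat ?y * e a" by simp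
qed

lemma even_Grassmann_central:
  assumes "x \<in> Grassmann" "hat x = x"
  shows "U * x = x * U"
proof (induction U rule: generated_induct)
  case (generator a)
  then show ?case using Grassmann_twisted_commute[OF assms(1)] assms(2) by simp
next
  case (mult U V)
  then show ?case by (metis mult.assoc)
qed (simp_all add: distrib_left distrib_right scale_mult_left scale_mult_right)

lemma odd_Grassmann_commute:
  assumes "x \<in> Grassmann" "hat x = - x"
  shows "U * x = x * hat U"
proof (induction U rule: generated_induct)
  case (generator a)
  then show ?case using Grassmann_twisted_commute[OF assms(1)] assms(2) by (simp add: hat_generator)
next
  case (mult U V)
  then show ?case by (metis mult.assoc hat_mult)
qed (simp_all add: distrib_left distrib_right scale_mult_left scale_mult_right)

text \<open>On generators, which are odd, a trivial twisted adjoint action says precisely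
  \<open>e a * T = hat T * e a\<close>. Conversely, the even part of an element of \<Lambda> is
  central and the odd part twisted-commutes with everything.\<close>

lemma units_Grassmann_eq_ker: "units Grassmann = ker_twisted_ad"
proof (intro equalityI subsetI)
  fix T assume "T \<in> ker_twisted_ad"
  then have T: "invertible T" "\<And>U. twisted_ad T U = U"
    by (auto simp: ker_twisted_ad_def units_def)
  have "T \<in> Grassmann"
  proof (rule twisted_commute_imp_Grassmann)
    fix a assume "a \<in> {1..n}"
    then have "twisted_ad T (0 + e a) = hat T * e a * mult_inv T"
      by (subst twisted_ad_eq) (simp_all add: parity_def hat_generator)
    then have "e a * T = hat T * e a * mult_inv T * T" using T(2) by simp
    then show "e a * T = hat T * e a" using T(1) by (simp add: mult_inv_cancel)
  qed
  with T(1) show "T \<in> units Grassmann" by (simp add: units_def)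
next
  fix T assume "T \<in> units Grassmann"
  then have T: "T \<in> Grassmann" "invertible T" by (auto simp: units_def)
  define T\<^sub>0 T\<^sub>1 where "T\<^sub>0 = (1 / 2) *s (T + hat T)" and "T\<^sub>1 = (1 / 2) *s (T - hat T)"
  have decomp: "T = T\<^sub>0 + T\<^sub>1" "hat T\<^sub>0 = T\<^sub>0" "hat T\<^sub>1 = - T\<^sub>1"
    using parity_decomposition[of T] by (simp_all only: T\<^sub>0_def T\<^sub>1_def parity_zero parity_one)
  have "T\<^sub>0 \<in> Grassmann" "T\<^sub>1 \<in> Grassmann"
    using T by (simp_all add: T\<^sub>0_def T\<^sub>1_def Grassmann_scale Grassmann_add Grassmann_diff)
  then have comm: "U * T\<^sub>0 = T\<^sub>0 * U" "U * T\<^sub>1 = T\<^sub>1 * hat U" for U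
    using decomp even_Grassmann_central odd_Grassmann_commute by auto
  have "twisted_ad T U = U" for U
  proof -
    obtain U\<^sub>0 U\<^sub>1 where U: "U = U\<^sub>0 + U\<^sub>1" "U\<^sub>0 \<in> parity 0" "U\<^sub>1 \<in> parity 1"
      using parity_decomposition by metis
    \<comment> \<open>Only the odd \<open>U\<^sub>1\<close> acquires a sign when crossing
      \<open>T\<^sub>1\<close>, which turns \<open>T\<^sub>0 + T\<^sub>1\<close> into
      \<open>T\<^sub>0 - T\<^sub>1 = hat T\<close>.\<close>
    have "U\<^sub>0 * T = T * U\<^sub>0" "U\<^sub>1 * T = hat T * U\<^sub>1"
      using U comm[of U\<^sub>0] comm[of U\<^sub>1] decomp
      by (simp_all add: parity_zero parity_one[unfolded One_nat_def] distrib_left distrib_right left_diff_distrib)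
    then have "twisted_ad T U = (U\<^sub>0 * T + U\<^sub>1 * T) * mult_inv T"
      using U twisted_ad_eq[of U\<^sub>0 U\<^sub>1 T] by (simp add: distrib_right)
    then show ?thesis
      using T(2) U(1) by (simp add: distrib_right mult_inv_cancel)
  qed
  with T show "T \<in> ker_twisted_ad" by (simp add: ker_twisted_ad_def units_def)
qed

text \<open>The augmentation ideal of \<Lambda>. Sums with one coefficient per null generator allow
  terms to be added one at a time when proving invertibility, and to be annihilated one at a time by
  the volume element.\<close>

definition null_ideal :: "'a set" where
  "null_ideal = {\<Sum>a\<in>{p + q + 1..n}. e a * y a | y. \<forall>a. y a \<in> Grassmann}"

lemma null_idealI:
  "x = (\<Sum>a\<in>{p + q + 1..n}. e a * y a) \<Longrightarrow> (\<And>a. y a \<in> Grassmann) \<Longrightarrow> x \<in> null_ideal"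
  by (auto simp: null_ideal_def)

lemma null_idealE:
  assumes "x \<in> null_ideal"
  obtains y where "x = (\<Sum>a\<in>{p + q + 1..n}. e a * y a)" "\<And>a. y a \<in> Grassmann"
  using assms by (auto simp: null_ideal_def)

lemma null_ideal_zero [simp]: "0 \<in> null_ideal"
  by (rule null_idealI[of _ "\<lambda>_. 0"]) simp_all

lemma null_ideal_add: "x \<in> null_ideal \<Longrightarrow> y \<in> null_ideal \<Longrightarrow> x + y \<in> null_ideal"
proof (elim null_idealE)
  fix u v
  assume "x = (\<Sum>a\<in>{p + q + 1..n}. e a * u a)" "\<And>a. u a \<in> Grassmann"
    "y = (\<Sum>a\<in>{p + q + 1..n}. e a * v a)" "\<And>a. v a \<in> Grassmann"
  then show "x + y \<in> null_ideal"
    by (intro null_idealI[of _ "\<lambda>a. u a + v a"])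
      (simp_all add: distrib_left sum.distrib Grassmann_add)
qed

lemma null_ideal_mult_right: "x \<in> null_ideal \<Longrightarrow> z \<in> Grassmann \<Longrightarrow> x * z \<in> null_ideal"
proof (elim null_idealE)
  fix u
  assume "z \<in> Grassmann" "x = (\<Sum>a\<in>{p + q + 1..n}. e a * u a)" "\<And>a. u a \<in> Grassmann"
  then show "x * z \<in> null_ideal"
    by (intro null_idealI[of _ "\<lambda>a. u a * z"])
      (simp_all add: sum_distrib_right mult.assoc Grassmann_mult)
qed

text \<open>Crossing \<open>e a\<close> turns \<open>z\<close> into \<open>hat z\<close>, which can
  be absorbed into the coefficient; hence the ideal is two-sided.\<close>

lemma null_ideal_mult_left: "x \<in> null_ideal \<Longrightarrow> z \<in> Grassmann \<Longrightarrow> z * x \<in> null_ideal"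
proof (elim null_idealE)
  fix u
  assume *: "z \<in> Grassmann" "x = (\<Sum>a\<in>{p + q + 1..n}. e a * u a)" "\<And>a. u a \<in> Grassmann"
  have "z * (e a * u a) = e a * (hat z * u a)" if "a \<in> {p + q + 1..n}" for a
    using Grassmann_twisted_commute'[OF *(1), of a] that by (simp flip: mult.assoc)
  with * show "z * x \<in> null_ideal"
    by (intro null_idealI[of _ "\<lambda>a. hat z * u a"])
      (simp_all add: sum_distrib_left Grassmann_mult)
qed

lemma null_ideal_scale: "x \<in> null_ideal \<Longrightarrow> c *s x \<in> null_ideal"
  using null_ideal_mult_left[of x "c *s 1"] by (simp add: Grassmann_scale scale_mult_left)

lemma null_ideal_hat: "x \<in> null_ideal \<Longrightarrow> hat x \<in> null_ideal"
proof (elim null_idealE)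
  fix u
  assume *: "x = (\<Sum>a\<in>{p + q + 1..n}. e a * u a)" "\<And>a. u a \<in> Grassmann"
  have "(- 1) *s hat (u a) \<in> Grassmann" for a
    using *(2) by (intro Grassmann_scale) simp
  with * show "hat x \<in> null_ideal"
    by (intro null_idealI[of _ "\<lambda>a. - hat (u a)"]) (simp_all add: hat_generator)
qed

lemma null_ideal_subset: "null_ideal \<subseteq> Grassmann"
  by (auto elim!: null_idealE intro!: Grassmann_sum Grassmann_mult Grassmann_generator)

lemma generator_in_null_ideal:
  assumes "a \<in> {p + q + 1..n}"
  shows "e a \<in> null_ideal"
proof (rule null_idealI)
  have "(\<Sum>b\<in>{p + q + 1..n}. e b * (if b = a then 1 else 0)) =
      (\<Sum>b\<in>{p + q + 1..n}. if b = a then e a else 0)"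
    by (intro sum.cong) auto
  then show "e a = (\<Sum>b\<in>{p + q + 1..n}. e b * (if b = a then 1 else 0))"
    using assms by simp
qed simp

text \<open>Scalars plus an ideal of \<Lambda> are closed under all algebra operations, and the
  generators of \<Lambda> lie in the ideal. Here \<open>c\<close> is the scalar part of
  \<open>x\<close>.\<close>

lemma Grassmann_decomposition:
  assumes "x \<in> Grassmann"
  obtains c j where "x = c *s 1 + j" "j \<in> null_ideal"
proof -
  have "\<exists>c. \<exists>j\<in>null_ideal. x = c *s 1 + j"
    using assms unfolding Grassmann_def
  proof (induction rule: subalgebra_hull_induct)
    case (generator x)
    then show ?case using generator_in_null_ideal by (intro exI[of _ 0]) auto
  next
    case one
    show ?case by (intro exI[of _ 1] bexI[of _ 0]) simp_all
  next
    case (add x y)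
    then obtain c d i j where "x = c *s 1 + i" "y = d *s 1 + j" "i \<in> null_ideal" "j \<in> null_ideal"
      by blast
    then show ?case
      by (intro exI[of _ "c + d"] bexI[of _ "i + j"])
        (simp_all add: scale_left_distrib null_ideal_add)
  next
    case (scale c x)
    then obtain d j where "x = d *s 1 + j" "j \<in> null_ideal" by blast
    then show ?case
      by (intro exI[of _ "c * d"] bexI[of _ "c *s j"])
        (simp_all add: scale_right_distrib null_ideal_scale)
  next
    case (mult x y)
    then obtain c d i j where "x = c *s 1 + i" "y = d *s 1 + j" "i \<in> null_ideal" "j \<in> null_ideal"
      by blast
    then show ?case
      using null_ideal_subset
      by (intro exI[of _ "c * d"] bexI[of _ "c *s j + d *s i + i * j"])
        (auto simp: distrib_left distrib_right scale_mult_left scale_mult_right scale_right_distrib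
          intro!: null_ideal_add null_ideal_scale null_ideal_mult_right)
  qed
  then show thesis using that by blast
qed

text \<open>Adding one term \<open>e\<^sub>a y\<close> to an invertible \<open>x\<close> multiplies \<open>x\<close> by \<open>1 + e\<^sub>a w\<close>, where
  \<open>(e\<^sub>a w)\<^sup>2 = e\<^sub>a\<^sup>2 \<cdot> \<dots> = 0\<close>.\<close>
lemma invertible_scalar_plus_null:
  assumes "c \<noteq> 0" "j \<in> null_ideal"
  shows "invertible (c *s 1 + j)"
proof -
  obtain y where j: "j = (\<Sum>a\<in>{p + q + 1..n}. e a * y a)" and y: "\<And>a. y a \<in> Grassmann"
    using assms(2) by (rule null_idealE) blast
  have "invertible (c *s 1 + (\<Sum>a\<in>S. e a * y a))" if "finite S" "S \<subseteq> {p + q + 1..n}" for S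
    using that
  proof (induction S)
    case empty
    then show ?case using assms(1) by (simp add: invertible_scale)
  next
    case (insert a S)
    define x where "x = c *s 1 + (\<Sum>a\<in>S. e a * y a)"
    have x: "invertible x" using insert by (simp add: x_def)
    have "x \<in> Grassmann"
      unfolding x_def using insert.prems y
      by (intro Grassmann_add Grassmann_scale Grassmann_sum Grassmann_mult Grassmann_generator Grassmann_one) auto
    then have inv: "mult_inv x \<in> Grassmann" using x by (rule Grassmann_mult_inv)
    have a: "a \<in> {1..n}" "p + q < a" using insert.prems by auto
    \<comment> \<open>Chosen so that \<open>mult_inv x * (e a * y a) = e a * w\<close>: the inverse
      of \<open>x\<close> becomes its \<open>hat\<close> when it crosses \<open>e a\<close>.\<close>
    define w where "w = hat (mult_inv x) * y a"
    have "w \<in> Grassmann" using inv y by (simp add: w_def Grassmann_mult)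
    then have "w * (e a * w) = e a * (hat w * w)"
      using Grassmann_twisted_commute'[of w a] a by (simp flip: mult.assoc)
    then have "(e a * w) * (e a * w) = (e a * e a) * (hat w * w)"
      by (simp add: mult.assoc)
    also have "\<dots> = 0" using generator_square[OF a(1)] a(2) by (simp add: eta_def)
    finally have "(1 + e a * w) * (1 - e a * w) = 1 \<and> (1 - e a * w) * (1 + e a * w) = 1"
      by (simp add: algebra_simps)
    then have "invertible (1 + e a * w)" unfolding invertible_def by blast
    moreover have "mult_inv x * (e a * y a) = e a * w"
      using Grassmann_twisted_commute'[OF inv a(1)] by (simp add: w_def flip: mult.assoc)
    then have "x * (1 + e a * w) = x + e a * y a"
      using x by (metis distrib_left mult.right_neutral mult_inv_cancel(1))
    ultimately have "invertible (x + e a * y a)" using x by (metis invertible_mult)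
    then show ?case using insert.hyps by (simp add: x_def add_ac)
  qed
  from this[of "{p + q + 1..n}"] show ?thesis by (simp add: j)
qed

text \<open>Otherwise \<open>- 1 *s 1 + 1 = 0\<close> would be invertible.\<close>

lemma one_notin_null_ideal: "1 \<notin> null_ideal"
  using invertible_scalar_plus_null[of "- 1" 1] by auto

text \<open>An inverse of \<open>j\<close> would lie in \<Lambda>, and the ideal would then contain
  \<open>j * mult_inv j = 1\<close>.\<close>

lemma null_ideal_not_invertible: "j \<in> null_ideal \<Longrightarrow> \<not> invertible j"
  using one_notin_null_ideal null_ideal_mult_right[of j "mult_inv j"] null_ideal_subset
    Grassmann_mult_inv invertible_inverse(1) by fastforce

lemma null_ideal_trivial: "r = 0 \<Longrightarrow> j \<in> null_ideal \<Longrightarrow> j = 0"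
  by (elim null_idealE) simp

subsection \<open>The volume element and the center\<close>

definition volume :: 'a where "volume = blade {1..n}"

lemma grade_zero_iff: "x \<in> grade 0 \<longleftrightarrow> (\<exists>c. x = c *s 1)"
proof -
  have "{blade A | A. A \<subseteq> {1..n} \<and> card A = 0} = {1}"
    using finite_subset[of _ "{1..n}"] by (auto intro: exI[of _ "{}"])
  then show ?thesis unfolding grade_def by (auto simp: span_singleton)
qed

lemma grade_top_iff: "x \<in> grade n \<longleftrightarrow> (\<exists>c. x = c *s volume)"
proof -
  have "A \<subseteq> {1..n} \<and> card A = n \<longleftrightarrow> A = {1..n}" for A
    using card_subset_eq[of "{1..n}" A] by auto
  then have "{blade A | A. A \<subseteq> {1..n} \<and> card A = n} = {volume}" by (auto simp: volume_def)
  then show ?thesis unfolding grade_def by (auto simp: span_singleton)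
qed

lemma generator_mult_volume:
  "a \<in> {1..n} \<Longrightarrow> e a * volume = - ((- 1) ^ n) *s (volume * e a)"
  using generator_mult_blade[of a "{1..n}"] by (simp add: reorder_sign_def volume_def)

lemma hat_volume: "hat volume = (- 1) ^ n *s volume"
  using hat_blade[of "{1..n}"] by (simp add: volume_def)

lemma null_generator_mult_volume:
  assumes "a \<in> {p + q + 1..n}"
  shows "e a * volume = 0" "volume * e a = 0"
proof -
  have a: "a \<in> {1..n}" "p + q < a" using assms by auto
  show "e a * volume = 0"
    unfolding volume_def
    using generator_mult_blade_symdiff[OF a(1) subset_refl] a by (metis scale_zero_left)
  then show "volume * e a = 0"
    using generator_mult_volume[OF a(1)] by auto
qed

lemma null_ideal_mult_volume:
  assumes "j \<in> null_ideal"
  shows "j * volume = 0" "volume * j = 0"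
proof -
  obtain y where j: "j = (\<Sum>a\<in>{p + q + 1..n}. e a * y a)" and y: "\<And>a. y a \<in> Grassmann"
    using assms by (rule null_idealE) blast
  have "e a * y a * volume = 0" if "a \<in> {p + q + 1..n}" for a
  proof -
    \<comment> \<open>This brings the null generator next to \<open>volume\<close>, which it
      annihilates.\<close>
    have "e a * y a = hat (y a) * e a"
      using that by (intro Grassmann_twisted_commute y) auto
    then show ?thesis using null_generator_mult_volume[OF that] by (simp add: mult.assoc)
  qed
  then show "j * volume = 0" unfolding j sum_distrib_right by (intro sum.neutral) blast
  have "volume * (e a * y a) = 0" if "a \<in> {p + q + 1..n}" for a
    using null_generator_mult_volume[OF that] by (simp flip: mult.assoc)
  then show "volume * j = 0" unfolding j sum_distrib_left by (intro sum.neutral) blast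
qed

text \<open>Moving the second copy of the least generator next to the first leaves a sign, the
  scalar \<open>e b * e b\<close> and the square of the shorter blade.\<close>

lemma blade_square:
  assumes "A \<subseteq> {1..n}"
  obtains c where "blade A * blade A = c *s 1"
proof -
  have "finite A" using assms by (rule finite_subset) simp
  then have "\<exists>c. blade A * blade A = c *s 1" using assms
  proof (induction A rule: finite_linorder_min_induct)
    case empty
    then show ?case by (intro exI[of _ 1]) simp
  next
    case (insert b A)
    then obtain c where c: "blade A * blade A = c *s 1" by auto
    have b: "b \<in> {1..n}" "A \<subseteq> {1..n}" using insert.prems by auto
    have "blade (insert b A) * blade (insert b A) = e b * blade A * (e b * blade A)"
      using insert.hyps by (simp add: blade_insert_min)
    also have "e b * blade A = reorder_sign b A *s (blade A * e b)"
      by (rule generator_mult_blade[OF b])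
    \<comment> \<open>The preceding rewriting reached both factors, so their two equal signs
      cancel.\<close>
    also have "\<dots> * (\<dots>) = blade A * (e b * (blade A * e b))"
      by (simp add: scale_mult_left scale_mult_right mult.assoc)
    also have "e b * (blade A * e b) = reorder_sign b A *s (blade A * (e b * e b))"
      using generator_mult_blade[OF b] by (simp add: scale_mult_left flip: mult.assoc)
    also have "\<dots> = (reorder_sign b A * eta p q r b b) *s blade A"
      using generator_square[OF b(1)] by (simp add: scale_mult_right)
    finally show ?case using c by (auto simp: scale_mult_right)
  qed
  then show thesis using that by blast
qed

text \<open>For \<open>r \<noteq> 0\<close> the last generator is null; \<open>volume\<close> is a
  nonzero multiple of a product starting with it, and \<open>volume * e n = 0\<close>.\<close>

lemma volume_square_degenerate:
  assumes "r \<noteq> 0"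
  shows "volume * volume = 0"
proof -
  have n: "n \<in> {1..n}" "n \<in> {p + q + 1..n}" "{1..n} - {n} \<subseteq> {1..n}" using assms by auto
  obtain c where c: "e n * blade ({1..n} - {n}) = c *s blade (sym_diff ({1..n} - {n}) {n})"
    and "c \<noteq> 0" using generator_mult_blade_symdiff[OF n(1,3)] by blast
  moreover have "sym_diff ({1..n} - {n}) {n} = {1..n}" using n(1) by blast
  ultimately have "c *s (volume * volume) = volume * (e n * blade ({1..n} - {n}))"
    by (simp add: scale_mult_right volume_def)
  also have "\<dots> = 0"
    using null_generator_mult_volume(2)[OF n(2)] by (simp flip: mult.assoc)
  finally show ?thesis using \<open>c \<noteq> 0\<close> by simp
qed

lemma scalar_volume_eq_iff:
  assumes "n \<ge> 1"
  shows "c *s 1 = d *s volume \<longleftrightarrow> c = 0 \<and> d = 0"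
proof
  assume "c *s 1 = d *s volume"
  then have "c *s blade {} = d *s blade {1..n}" by (simp add: volume_def)
  with blade_scale_eq_imp_zero[of "{}" "{1..n}" c d] blade_scale_eq_imp_zero[of "{1..n}" "{}" d c] assms
  show "c = 0 \<and> d = 0" by auto
qed simp

text \<open>Since \<open>r \<noteq> n\<close>, the generator \<open>e 1\<close> has nonzero square.
  The grading and reordering signs give \<open>hat volume * e 1 = - (e 1 * volume)\<close> for
  either parity of \<open>n\<close>, so twisted commutation with \<open>e 1\<close> forces
  \<open>c = 0\<close>.\<close>

lemma volume_Grassmann_iff:
  assumes "r \<noteq> n"
  shows "c *s volume \<in> Grassmann \<longleftrightarrow> c = 0"
proof
  assume in_Grassmann: "c *s volume \<in> Grassmann"
  have one: "1 \<in> {1..n}" "1 \<le> p + q" using assms by auto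
  have "c *s (e 1 * volume) = hat (c *s volume) * e 1"
    using Grassmann_twisted_commute[OF in_Grassmann one(1)] by (simp add: scale_mult_right)
  also have "\<dots> = (c * (- 1) ^ n) *s (volume * e 1)"
    by (simp add: hat_volume scale_mult_left mult.commute)
  also have "\<dots> = - c *s (e 1 * volume)"
    using generator_mult_volume[OF one(1)] by (simp flip: power_mult_distrib mult.assoc)
  finally have "c *s (e 1 * volume) + c *s (e 1 * volume) = 0"
    by (simp only: scale_minus_left eq_neg_iff_add_eq_0)
  then have "c *s (e 1 * volume) = 0"
    by (metis scale_half_double scale_zero_right)
  then have "c *s (e 1 * (e 1 * volume)) = 0" by (metis scale_mult_right mult_zero_right)
  then have "(c * eta p q r 1 1) *s volume = 0"
    using generator_square[OF one(1)] by (simp add: scale_mult_left flip: mult.assoc)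
  then show "c = 0"
    using one(2) eta_eq_zero_iff[of 1] blade_neq_zero[of "{1..n}"]
    by (auto simp: volume_def simp del: One_nat_def)
qed simp

section \<open>The plane spanned by \<open>1\<close> and the volume element\<close>

definition pseudoscalar_plane :: "'a set" where
  "pseudoscalar_plane = grade 0 + grade n"

lemma pseudoscalar_plane_iff: "x \<in> pseudoscalar_plane \<longleftrightarrow> (\<exists>c d. x = c *s 1 + d *s volume)"
  unfolding pseudoscalar_plane_def set_plus_def by (fastforce simp: grade_zero_iff grade_top_iff)

lemma pseudoscalar_plane_mult:
  assumes "x \<in> pseudoscalar_plane" "y \<in> pseudoscalar_plane"
  shows "x * y \<in> pseudoscalar_plane"
proof -
  obtain k where k: "volume * volume = k *s 1"
    unfolding volume_def using blade_square[of "{1..n}"] by blast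
  obtain a b c d where "x = a *s 1 + b *s volume" "y = c *s 1 + d *s volume"
    using assms by (auto simp: pseudoscalar_plane_iff)
  then have "x * y = (a * c + b * d * k) *s 1 + (a * d + b * c) *s volume"
    by (simp add: distrib_left distrib_right scale_mult_left scale_mult_right
        scale_left_distrib scale_right_distrib k mult_ac add_ac)
  then show ?thesis by (auto simp: pseudoscalar_plane_iff)
qed

lemma pseudoscalar_plane_hat: "x \<in> pseudoscalar_plane \<Longrightarrow> hat x \<in> pseudoscalar_plane"
  unfolding pseudoscalar_plane_iff by (auto simp: hat_volume) (metis scale_scale)

text \<open>The inverse is the conjugate \<open>c *s 1 - d *s volume\<close> divided by the scalar
  \<open>s = c * c - d * d * k\<close>. If \<open>s\<close> were zero, cancelling \<open>x\<close>
  would make the conjugate zero, and then \<open>x\<close> as well.\<close>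

lemma pseudoscalar_plane_mult_inv:
  assumes "n \<ge> 1" "x \<in> pseudoscalar_plane" "invertible x"
  shows "mult_inv x \<in> pseudoscalar_plane"
proof -
  obtain k where k: "volume * volume = k *s 1"
    unfolding volume_def using blade_square[of "{1..n}"] by blast
  obtain c d where x: "x = c *s 1 + d *s volume"
    using assms by (auto simp: pseudoscalar_plane_iff)
  define y where "y = c *s 1 - d *s volume"
  define s where "s = c * c - d * d * k"
  have xy: "x * y = s *s 1" "y * x = s *s 1"
    by (simp_all add: x y_def s_def k distrib_left distrib_right left_diff_distrib right_diff_distrib
        scale_mult_left scale_mult_right scale_left_diff_distrib scale_right_diff_distrib
        scale_right_distrib mult.commute mult.left_commute)
  have "s \<noteq> 0"
  proof
    assume "s = 0"
    then have "x * y = x * 0" using xy by simp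
    then have "y = 0" using assms(3) invertible_cancel_left by blast
    then have "c = 0 \<and> d = 0" using scalar_volume_eq_iff[OF assms(1)] by (simp add: y_def)
    then show False using assms(3) x by simp
  qed
  then have "mult_inv x = inverse s *s y"
    using xy by (intro mult_inv_unique) (simp_all add: scale_mult_left scale_mult_right)
  also have "\<dots> = (inverse s * c) *s 1 + (- (inverse s * d)) *s volume"
    by (simp add: y_def scale_right_diff_distrib)
  finally show ?thesis unfolding pseudoscalar_plane_iff by blast
qed

lemma pseudoscalar_plane_central:
  assumes "odd n" "x \<in> pseudoscalar_plane"
  shows "x * y = y * x"
proof -
  have volume: "volume * y = y * volume"
  proof (induction y rule: generated_induct)
    case (generator a)
    then show ?case using generator_mult_volume[of a] assms(1) by simp
  next
    case (mult x y)
    then show ?case by (metis mult.assoc)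
  qed (simp_all add: distrib_left distrib_right scale_mult_left scale_mult_right)
  obtain c d where "x = c *s 1 + d *s volume"
    using assms by (auto simp: pseudoscalar_plane_iff)
  then show ?thesis
    using volume by (simp add: distrib_left distrib_right scale_mult_left scale_mult_right)
qed

text \<open>Commutation with \<open>e a\<close> forces \<open>reorder_sign a A = 1\<close> unless
  \<open>a\<close> is a null index in \<open>A\<close>. For even \<open>card A\<close> the sign is
  \<open>-1\<close> at each \<open>a \<in> A\<close>, so these are all null; for odd
  \<open>card A\<close> it is \<open>-1\<close> at each \<open>a\<close> outside \<open>A\<close>,
  so there is no such \<open>a\<close>.\<close>

lemma central_coefficient:
  assumes "(\<Sum>A\<in>Pow {1..n}. t A *s blade A) \<in> center" "A \<subseteq> {1..n}" "t A \<noteq> 0"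
  shows "A \<subseteq> {p + q + 1..n} \<or> A = {1..n} \<and> odd n"
proof -
  define x where "x = (\<Sum>A\<in>Pow {1..n}. t A *s blade A)"
  have sign: "reorder_sign a A = (1::'f)" if a: "a \<in> {1..n}" "\<not> (a \<in> A \<and> p + q < a)" for a
  proof -
    have right: "blade B * e a = reorder_sign a B *s (e a * blade B)" if "B \<subseteq> {1..n}" for B
      using generator_mult_blade[OF a(1) that] by simp
    have "(\<Sum>B\<in>Pow {1..n}. (t B * (1 - reorder_sign a B)) *s (e a * blade B)) = e a * x - x * e a"
      unfolding x_def sum_distrib_left sum_distrib_right
        scale_mult_left scale_mult_right sum_subtractf[symmetric]
      by (intro sum.cong refl)
        (simp add: right scale_left_diff_distrib right_diff_distrib)
    also have "\<dots> = 0" using assms(1) by (simp add: x_def center_def)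
    finally have "t A * (1 - reorder_sign a A) = 0"
      using a(2) by (intro generator_mult_combination_zero[OF _ a(1) assms(2)]) auto
    then show ?thesis using assms(3) by simp
  qed
  have minus_one: "- 1 \<noteq> (1::'f)"
    by (metis add_neg_numeral_special(8) eq_neg_iff_add_eq_0 one_add_one two_neq_zero)
  show ?thesis
  proof (cases "even (card A)")
    case True
    have "a \<in> {p + q + 1..n}" if "a \<in> A" for a
    proof (rule ccontr)
      assume "a \<notin> {p + q + 1..n}"
      then have "a \<in> {1..n}" "\<not> p + q < a" using that assms(2) by auto
      then show False
        using sign[of a] that True minus_one by (simp add: reorder_sign_def)
    qed
    then show ?thesis by blast
  next
    case False
    have "a \<in> A" if "a \<in> {1..n}" for a
      using sign[of a] that False minus_one by (cases "a \<in> A") (auto simp: reorder_sign_def)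
    then have "A = {1..n}" using assms(2) by blast
    with False show ?thesis by simp
  qed
qed

lemma center_subset_Grassmann:
  assumes "even n"
  shows "center \<subseteq> Grassmann"
proof
  fix x :: 'a assume "x \<in> center"
  moreover obtain t where x: "x = (\<Sum>A\<in>Pow {1..n}. t A *s blade A)" by (rule blade_expansion)
  ultimately have "t A = 0 \<or> A \<subseteq> {p + q + 1..n}" if "A \<subseteq> {1..n}" for A
    using central_coefficient[of t A] that assms by blast
  then have "t A *s blade A \<in> Grassmann" if "A \<subseteq> {1..n}" for A
    using that Grassmann_scale Grassmann_blade by (metis Grassmann_zero scale_zero_left)
  then show "x \<in> Grassmann" unfolding x by (intro Grassmann_sum) blast
qed

section \<open>The subspace \<open>Grassmann + grade n\<close> and the factorization of its
  units\<close>

lemma subspace_Grassmann_plus_top: "subspace (Grassmann + grade n)"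
proof -
  have "subspace Grassmann" using Grassmann_subalgebra by (simp add: subalgebra_def)
  moreover have "subspace (grade n)" unfolding grade_def by (rule subspace_span)
  ultimately have "subspace {x + y | x y. x \<in> Grassmann \<and> y \<in> grade n}" by (rule subspace_sums)
  also have "{x + y | x y. x \<in> Grassmann \<and> y \<in> grade n} = Grassmann + grade n"
    by (auto simp: set_plus_def)
  finally show ?thesis .
qed

lemma Grassmann_plus_topE:
  assumes "x \<in> Grassmann + grade n"
  obtains l d where "x = l + d *s volume" "l \<in> Grassmann"
  using assms by (auto simp: set_plus_def grade_top_iff)

lemma Grassmann_plus_topI: "l \<in> Grassmann \<Longrightarrow> l + d *s volume \<in> Grassmann + grade n"
  by (intro set_plus_intro) (auto simp: grade_top_iff)

lemma Grassmann_subset_plus_top: "Grassmann \<subseteq> Grassmann + grade n"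
  using Grassmann_plus_topI[of _ 0] by auto

lemma center_subset_Grassmann_plus_top: "center \<subseteq> Grassmann + grade n"
proof
  fix x :: 'a assume "x \<in> center"
  moreover obtain t where x: "x = (\<Sum>A\<in>Pow {1..n}. t A *s blade A)" by (rule blade_expansion)
  ultimately have t: "t A = 0 \<or> A \<subseteq> {p + q + 1..n} \<or> A = {1..n}" if "A \<subseteq> {1..n}" for A
    using central_coefficient[of t A] that by blast
  have "t A *s blade A \<in> Grassmann + grade n" if "A \<subseteq> {1..n}" for A
  proof -
    consider "t A *s blade A \<in> Grassmann" | "A = {1..n}"
      using t[OF \<open>A \<subseteq> {1..n}\<close>] Grassmann_scale Grassmann_blade
      by (metis Grassmann_zero scale_zero_left)
    then show ?thesis
      using Grassmann_subset_plus_top Grassmann_plus_topI[of 0 "t A"]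
      by cases (auto simp: volume_def)
  qed
  then show "x \<in> Grassmann + grade n"
    unfolding x by (intro subspace_sum[OF subspace_Grassmann_plus_top]) blast
qed

text \<open>If the scalar part \<open>c\<close> of \<open>l\<close> is nonzero, \<open>l\<close>
  itself is invertible and splits off. If \<open>c = 0\<close>, invertibility of \<open>x\<close>
  forces \<open>r = 0\<close>, and \<open>x\<close> is a multiple of \<open>volume\<close>.\<close>

lemma units_Grassmann_plus_top_factor:
  assumes "x \<in> Grassmann + grade n" "invertible x"
  obtains k l where "k \<in> units pseudoscalar_plane" "l \<in> units Grassmann" "x = k * l"
proof -
  obtain l d where x: "x = l + d *s volume" and l: "l \<in> Grassmann"
    using assms(1) by (rule Grassmann_plus_topE)
  obtain c j where cj: "l = c *s 1 + j" "j \<in> null_ideal"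
    using l by (rule Grassmann_decomposition)
  show thesis
  proof (cases "c = 0")
    case False
    then have inv: "invertible l" using cj by (simp add: invertible_scalar_plus_null)
    \<comment> \<open>The quotient \<open>d / c\<close> is right because
      \<open>volume * l = c *s volume\<close>.\<close>
    define k where "k = 1 *s 1 + (d / c) *s volume"
    have "k * l = x"
      using False null_ideal_mult_volume[OF cj(2)]
      by (simp add: k_def x cj(1) distrib_left distrib_right scale_mult_left scale_mult_right
          scale_right_distrib)
    moreover have "invertible k"
      using \<open>k * l = x\<close> assms(2) inv by (metis invertible_mult invertible_mult_inv mult_inv_cancel(4))
    moreover have "k \<in> pseudoscalar_plane" unfolding k_def pseudoscalar_plane_iff by blast
    ultimately show ?thesis using that[of k l] l inv by (simp add: units_def)
  next
    case True
    have "r = 0"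
    proof (rule ccontr)
      assume "r \<noteq> 0"
      \<comment> \<open>All products involving \<open>volume\<close> vanish, so the square of
        \<open>x\<close> falls into the null ideal, which contains no units.\<close>
      have "x * x = j * j"
        using volume_square_degenerate[OF \<open>r \<noteq> 0\<close>] null_ideal_mult_volume[OF cj(2)]
        by (simp add: x cj(1) True distrib_left distrib_right scale_mult_left scale_mult_right)
      moreover have "j * j \<in> null_ideal"
        using cj(2) null_ideal_subset by (auto intro: null_ideal_mult_right)
      ultimately show False
        using assms(2) null_ideal_not_invertible by (metis invertible_mult)
    qed
    then have "j = 0" using null_ideal_trivial cj(2) by blast
    then have "x \<in> pseudoscalar_plane"
      unfolding pseudoscalar_plane_iff x cj(1) by auto
    then show ?thesis using that[of x 1] assms(2) by (simp add: units_def)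
  qed
qed

subsection \<open>The groups\<close>

lemma P_pm_iff: "x \<in> P_pm \<longleftrightarrow> invertible x \<and> (hat x = x \<or> hat x = - x)"
  by (auto simp: P_pm_def units_def parity_def)

lemma hat_mult_inv_mult_eq_iff:
  assumes "invertible T"
  shows "hat (mult_inv T) * T = M \<longleftrightarrow> T = hat T * M"
  using assms by (metis hat_mult_inv invertible_hat mult_inv_cancel(1,2))

text \<open>The factor \<open>hat (mult_inv u) * u\<close> in the middle is \<open>1\<close> or
  \<open>- 1\<close> for homogeneous \<open>u\<close>.\<close>

lemma hat_mult_inv_mult_parity:
  assumes "u \<in> P_pm" "invertible x"
  shows "hat (mult_inv (u * x)) * (u * x) = hat (mult_inv x) * x
    \<or> hat (mult_inv (u * x)) * (u * x) = - (hat (mult_inv x) * x)"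
proof -
  have u: "invertible u" "hat u = u \<or> hat u = - u" using assms(1) by (auto simp: P_pm_iff)
  have "u * x = hat (u * x) * (hat (mult_inv x) * x) \<or> u * x = hat (u * x) * - (hat (mult_inv x) * x)"
    using u(2) assms(2) by (auto simp: mult.assoc hat_mult_inv mult_inv_cancel)
  then show ?thesis
    using u(1) assms(2) by (simp add: hat_mult_inv_mult_eq_iff)
qed

lemma factor_by_parity:
  assumes "invertible T" "T = hat T * M" "invertible (hat M + 1) \<or> invertible (hat M - 1)"
  obtains u s where "u \<in> P_pm" "s = 1 \<or> s = - 1" "invertible (hat M + s)"
    "T = u * mult_inv (hat M + s)"
proof -
  obtain s where s: "s = 1 \<or> s = - 1" "invertible (hat M + s)"
    using assms(3) by (metis diff_conv_add_uminus)
  have "hat T = T * hat M" using arg_cong[OF assms(2), of hat] by simp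
  then have u: "T * (hat M + s) = hat T + T * s" by (simp add: distrib_left)
  have "T * (hat M + s) \<in> P_pm"
    unfolding P_pm_iff
  proof
    show "invertible (T * (hat M + s))" using assms(1) s(2) by simp
    show "hat (T * (hat M + s)) = T * (hat M + s) \<or> hat (T * (hat M + s)) = - (T * (hat M + s))"
      unfolding u using s(1) by (auto simp: add.commute)
  qed
  moreover have "T = T * (hat M + s) * mult_inv (hat M + s)"
    using s(2) by (simp add: mult_inv_cancel)
  ultimately show thesis using that s by blast
qed

lemma units_Grassmann_times: "units Grassmann * units Grassmann = units Grassmann"
  by (intro units_times_units Grassmann_mult) simp_all

text \<open>A homogeneous factor changes the quotient only by a sign, and quotients of elements of
  \<Lambda> stay in \<Lambda>. Conversely, \<open>factor_by_parity\<close> splits \<open>T\<close>,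
  and its second factor is the inverse of an element of \<Lambda>.\<close>

lemma P_pm_Lambda_eq_ratio:
  "P_pm_Lambda = {T \<in> units UNIV. hat (mult_inv T) * T \<in> units Grassmann}"
proof (intro equalityI subsetI)
  fix T assume "T \<in> P_pm_Lambda"
  then obtain u l where T: "T = u * l" "u \<in> P_pm" "l \<in> Grassmann" "invertible l"
    by (auto simp: P_pm_Lambda_def set_times_def units_def)
  then have inv: "invertible T" by (simp add: P_pm_iff)
  have "hat (mult_inv l) * l \<in> Grassmann"
    using T by (intro Grassmann_mult) (simp_all add: Grassmann_mult_inv)
  moreover from this have "- (hat (mult_inv l) * l) \<in> Grassmann"
    using Grassmann_diff[of 0] by simp
  ultimately have "hat (mult_inv T) * T \<in> Grassmann"
    using hat_mult_inv_mult_parity[OF T(2,4)] unfolding T(1) by metis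
  with inv show "T \<in> {T \<in> units UNIV. hat (mult_inv T) * T \<in> units Grassmann}"
    by (simp add: units_def)
next
  fix T assume "T \<in> {T \<in> units UNIV. hat (mult_inv T) * T \<in> units Grassmann}"
  then have inv: "invertible T" and M_in: "hat (mult_inv T) * T \<in> Grassmann"
    by (auto simp: units_def)
  define M where "M = hat (mult_inv T) * T"
  have T: "T = hat T * M" unfolding M_def using hat_mult_inv_mult_eq_iff[OF inv] by blast
  have hat_M: "hat M \<in> Grassmann" using M_in unfolding M_def Grassmann_hat .
  obtain c j where cj: "hat M = c *s 1 + j" "j \<in> null_ideal"
    using hat_M by (rule Grassmann_decomposition)
  \<comment> \<open>Adding \<open>d\<close> shifts the scalar part to \<open>c + d\<close>; the
    shifts \<open>1\<close> and \<open>- 1\<close> cannot both produce zero.\<close>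
  have shift: "invertible (hat M + d *s 1)" if "c + d \<noteq> 0" for d
    using invertible_scalar_plus_null[OF that cj(2)] by (simp add: cj(1) scale_left_distrib add_ac)
  have "c + 1 \<noteq> 0 \<or> c + - 1 \<noteq> 0"
    using one_add_or_one_diff_neq_zero[of c] by (auto simp: add.commute)
  then have "invertible (hat M + 1) \<or> invertible (hat M - 1)"
    using shift[of 1] shift[of "- 1"] by auto
  from factor_by_parity[OF inv T this] obtain u s where u: "u \<in> P_pm" "s = 1 \<or> s = - 1"
    "invertible (hat M + s)" "T = u * mult_inv (hat M + s)" by blast
  have "hat M + s \<in> Grassmann"
    using u(2) hat_M Grassmann_add[of _ 1] Grassmann_diff[of _ 1] by fastforce
  then have "mult_inv (hat M + s) \<in> units Grassmann"
    using u(3) by (simp add: units_def Grassmann_mult_inv)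
  then show "T \<in> P_pm_Lambda"
    using u by (auto simp: P_pm_Lambda_def set_times_def)
qed

text \<open>For even \<open>n\<close> the central units already belong to \<Lambda> and are absorbed
  by its unit group.\<close>

lemma P_Lambda_even:
  assumes "even n"
  shows "P_Lambda = P_pm_Lambda"
proof -
  have "units center \<subseteq> units Grassmann"
    by (rule units_mono[OF center_subset_Grassmann[OF assms]])
  then have "units center * units Grassmann \<subseteq> units Grassmann"
    using units_Grassmann_times set_times_mono2 by (metis subset_refl)
  moreover have "(1::'a) \<in> units center" by (simp add: units_def center_def)
  then have "units Grassmann \<subseteq> units center * units Grassmann"
    by (force simp: set_times_def)
  ultimately show ?thesis
    unfolding P_Lambda_def P_def P_pm_Lambda_def by (simp add: mult.assoc)
qed

text \<open>Central units lie in \<open>Grassmann + grade n\<close> and therefore factor through the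
  pseudoscalar plane and \<Lambda>; for odd \<open>n\<close> the plane is in turn central.\<close>

lemma P_Lambda_odd:
  assumes "odd n"
  shows "P_Lambda = P_pm * units pseudoscalar_plane * units Grassmann"
proof -
  have "units center * units Grassmann = units pseudoscalar_plane * units Grassmann"
  proof
    have "units pseudoscalar_plane \<subseteq> units center"
      using pseudoscalar_plane_central[OF assms] by (intro units_mono) (auto simp: center_def)
    then show "units pseudoscalar_plane * units Grassmann \<subseteq> units center * units Grassmann"
      by (intro set_times_mono2) auto
    have "units center \<subseteq> units pseudoscalar_plane * units Grassmann"
    proof
      fix z :: 'a assume "z \<in> units center"
      then have "z \<in> Grassmann + grade n" "invertible z"
        using center_subset_Grassmann_plus_top by (auto simp: units_def)
      then show "z \<in> units pseudoscalar_plane * units Grassmann"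
        by (metis units_Grassmann_plus_top_factor set_times_intro)
    qed
    then have "units center * units Grassmann \<subseteq>
        units pseudoscalar_plane * units Grassmann * units Grassmann"
      by (intro set_times_mono2) auto
    then show "units center * units Grassmann \<subseteq> units pseudoscalar_plane * units Grassmann"
      by (simp add: mult.assoc units_Grassmann_times)
  qed
  then show ?thesis unfolding P_Lambda_def P_def by (simp add: mult.assoc)
qed

text \<open>For \<open>T = u * (k * l)\<close> the quotient is, up to sign, the product of the
  quotients of \<open>k\<close> and \<open>l\<close>, since the former is central. Conversely, the
  shifted \<open>hat M\<close> is shown to be invertible and is factored into a plane unit and a
  unit of \<Lambda>.\<close>

lemma P_Lambda_odd_eq_ratio:
  assumes "odd n"
  shows "P_Lambda = {T \<in> units UNIV. hat (mult_inv T) * T \<in> units (Grassmann + grade n)}"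
proof (intro equalityI subsetI)
  fix T assume "T \<in> P_Lambda"
  then obtain u k l where T: "T = u * (k * l)" "u \<in> P_pm"
    and k: "k \<in> pseudoscalar_plane" "invertible k" and l: "l \<in> Grassmann" "invertible l"
    unfolding P_Lambda_odd[OF assms] by (auto simp: set_times_def units_def mult.assoc)
  then have inv: "invertible T" by (simp add: P_pm_iff)
  have n: "n \<ge> 1" using assms by (cases n) auto
  have "mult_inv k \<in> pseudoscalar_plane"
    using k by (intro pseudoscalar_plane_mult_inv[OF n])
  then have hat_k: "hat (mult_inv k) \<in> pseudoscalar_plane" by (rule pseudoscalar_plane_hat)
  have "hat (mult_inv k) * k \<in> pseudoscalar_plane"
    using hat_k k(1) by (rule pseudoscalar_plane_mult)
  then obtain c d where cd: "hat (mult_inv k) * k = c *s 1 + d *s volume"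
    unfolding pseudoscalar_plane_iff by blast
  have l': "hat (mult_inv l) * l \<in> Grassmann" (is "?l \<in> _")
    using l by (intro Grassmann_mult) (simp_all add: Grassmann_mult_inv)
  then obtain b j where bj: "?l = b *s 1 + j" "j \<in> null_ideal"
    by (rule Grassmann_decomposition)
  have "hat (mult_inv (k * l)) * (k * l) = hat (mult_inv l) * (hat (mult_inv k) * k) * l"
    using k l by (simp add: mult_inv_mult mult.assoc)
  also have "\<dots> = (hat (mult_inv k) * k) * ?l"
    using pseudoscalar_plane_central[OF assms pseudoscalar_plane_mult[OF hat_k k(1)]]
    by (simp add: mult.assoc)
  \<comment> \<open>Next to \<open>volume\<close> only the scalar part \<open>b\<close> of
    \<open>?l\<close> survives.\<close>
  also have "\<dots> = c *s ?l + (d * b) *s volume"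
    unfolding cd distrib_right using null_ideal_mult_volume[OF bj(2)]
    by (simp add: bj(1) scale_mult_left scale_mult_right scale_right_distrib distrib_left
        mult.commute)
  also have "\<dots> \<in> Grassmann + grade n"
    using l' by (intro Grassmann_plus_topI Grassmann_scale)
  finally have "hat (mult_inv (k * l)) * (k * l) \<in> Grassmann + grade n" .
  then have "hat (mult_inv T) * T \<in> Grassmann + grade n"
    using hat_mult_inv_mult_parity[OF T(2), of "k * l"] k l
      subspace_neg[OF subspace_Grassmann_plus_top] unfolding T(1) by (metis invertible_mult)
  with inv show "T \<in> {T \<in> units UNIV. hat (mult_inv T) * T \<in> units (Grassmann + grade n)}"
    by (simp add: units_def)
next
  fix T assume "T \<in> {T \<in> units UNIV. hat (mult_inv T) * T \<in> units (Grassmann + grade n)}"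
  then have inv: "invertible T" and M_in: "hat (mult_inv T) * T \<in> Grassmann + grade n"
    by (auto simp: units_def)
  define M where "M = hat (mult_inv T) * T"
  have T: "T = hat T * M" unfolding M_def using hat_mult_inv_mult_eq_iff[OF inv] by blast
  have hat_T: "hat T = T * hat M" using arg_cong[OF T, of hat] by simp
  have M_hat_M: "M * hat M = 1"
    using T hat_T inv invertible_cancel_left[of "hat T" "M * hat M" 1]
    by (metis invertible_hat mult.assoc mult.right_neutral)
  have hat_M_M: "hat M * M = 1"
    using arg_cong[OF M_hat_M, of hat] by simp
  obtain l d where M: "M = l + d *s volume" and l: "l \<in> Grassmann"
    using M_in unfolding M_def by (rule Grassmann_plus_topE)
  have hat_M: "hat M = hat l + (- d) *s volume" using assms by (simp add: M hat_volume)
  obtain c j where cj: "l = c *s 1 + j" "j \<in> null_ideal"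
    using l by (rule Grassmann_decomposition)
  \<comment> \<open>For odd \<open>n\<close>, \<open>hat\<close> negates \<open>volume\<close>, so
    the top-grade parts cancel and the scalar part doubles.\<close>
  have sum: "M + hat M = (c + c) *s 1 + (j + hat j)"
    unfolding hat_M unfolding M cj(1) scale_left_distrib by simp
  have shift: "invertible (hat M + s *s 1)" if s: "s = 1 \<or> s = - 1" and "1 + c * s \<noteq> 0" for s
  proof (rule invertible_factor_left)
    have nonzero: "2 * (1 + c * s) \<noteq> 0"
      using that(2) two_neq_zero unfolding mult_eq_0_iff by blast
    \<comment> \<open>With \<open>hat M * M = 1\<close> and \<open>s * s = 1\<close> the product
      lands in \<Lambda> with scalar part \<open>2 * (1 + c * s)\<close>, where the invertibility
      criterion applies.\<close>
    have "(hat M + s *s 1) * (M + s *s 1) = 2 *s 1 + s *s (M + hat M)"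
      using s hat_M_M scale_left_distrib[of 1 1 1]
      by (auto simp: distrib_left distrib_right scale_mult_right scale_mult_left algebra_simps)
    also have "\<dots> = (2 * (1 + c * s)) *s 1 + s *s (j + hat j)"
      unfolding sum mult_2 by (simp add: scale_right_distrib scale_left_distrib algebra_simps)
    finally show "invertible ((hat M + s *s 1) * (M + s *s 1))"
      using invertible_scalar_plus_null[OF nonzero, of "s *s (j + hat j)"] cj(2)
      by (simp only: null_ideal_scale null_ideal_add null_ideal_hat)
    show "(hat M + s *s 1) * (M + s *s 1) = (M + s *s 1) * (hat M + s *s 1)"
      using s hat_M_M M_hat_M by (auto simp: algebra_simps)
  qed
  have "1 + c * 1 \<noteq> 0 \<or> 1 + c * (- 1) \<noteq> 0"
    using one_add_or_one_diff_neq_zero[of c] by simp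
  then have "invertible (hat M + 1) \<or> invertible (hat M - 1)"
    using shift[of 1] shift[of "- 1"] by auto
  from factor_by_parity[OF inv T this] obtain u s where u: "u \<in> P_pm" "s = 1 \<or> s = - 1"
    "invertible (hat M + s)" "T = u * mult_inv (hat M + s)" by blast
  have s: "s \<in> Grassmann" using u(2) Grassmann_diff[of 0 1] by auto
  have "hat M + s = (hat l + s) + (- d) *s volume" by (simp add: hat_M)
  also have "\<dots> \<in> Grassmann + grade n"
    using l s by (intro Grassmann_plus_topI Grassmann_add) simp_all
  finally obtain k m where km: "k \<in> units pseudoscalar_plane" "m \<in> units Grassmann"
    "hat M + s = k * m"
    using units_Grassmann_plus_top_factor u(3) by metis
  have n: "n \<ge> 1" using assms by (cases n) auto
  have k: "mult_inv k \<in> units pseudoscalar_plane"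
    using km(1) by (simp add: units_def pseudoscalar_plane_mult_inv[OF n])
  have m: "mult_inv m \<in> units Grassmann"
    using km(2) by (simp add: units_def Grassmann_mult_inv)
  have "mult_inv (hat M + s) = mult_inv m * mult_inv k"
    using km by (simp add: units_def mult_inv_mult)
  \<comment> \<open>Centrality of the plane restores the order of factors in
    \<open>P_Lambda_odd\<close>.\<close>
  also have "\<dots> = mult_inv k * mult_inv m"
    using k pseudoscalar_plane_central[OF assms, of "mult_inv k" "mult_inv m"]
    by (simp add: units_def)
  finally have "T = u * mult_inv k * mult_inv m" using u(4) by (simp add: mult.assoc)
  then show "T \<in> P_Lambda"
    unfolding P_Lambda_odd[OF assms] using u(1) k m by (auto intro!: set_times_intro)
qed

text \<open>With \<open>M = c + j + d\<omega>\<close>, the \<open>\<omega>\<close>-component of \<open>M \<cdot> hat M = 1\<close> is \<open>2cd\<close>. If \<open>c = 0\<close>, then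
  \<open>r = 0\<close> and \<open>M = d\<omega>\<close>, which twisted-commutes with everything, so that \<open>T = hat T \<cdot> M = M T\<close>.\<close>
lemma ratio_Grassmann_even:
  assumes n: "even n" "n \<ge> 1" "r \<noteq> n" and inv: "invertible T"
    and M_in: "hat (mult_inv T) * T \<in> Grassmann + grade n"
  shows "hat (mult_inv T) * T \<in> Grassmann"
proof -
  define M where "M = hat (mult_inv T) * T"
  have T: "T = hat T * M" unfolding M_def using hat_mult_inv_mult_eq_iff[OF inv] by blast
  have hat_T: "hat T = T * hat M" using arg_cong[OF T, of hat] by simp
  have M_hat_M: "M * hat M = 1"
    using T hat_T inv invertible_cancel_left[of "hat T" "M * hat M" 1]
    by (metis invertible_hat mult.assoc mult.right_neutral)
  obtain l d where M: "M = l + d *s volume" and l: "l \<in> Grassmann"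
    using M_in unfolding M_def by (rule Grassmann_plus_topE)
  obtain c j where cj: "l = c *s 1 + j" "j \<in> null_ideal"
    using l by (rule Grassmann_decomposition)
  obtain k where k: "volume * volume = k *s 1"
    unfolding volume_def using blade_square[of "{1..n}"] by blast
  have hat_j: "hat j \<in> null_ideal" using cj(2) by (rule null_ideal_hat)
  have hat_M: "hat M = hat l + d *s volume" using n(1) by (simp add: M hat_volume)
  \<comment> \<open>The part of \<open>M * hat M\<close> in the null ideal; products of
    \<open>j\<close> and \<open>hat j\<close> with \<open>volume\<close> vanish.\<close>
  define i where "i = c *s hat j + c *s j + j * hat j"
  have i: "i \<in> null_ideal"
    using cj(2) hat_j null_ideal_subset unfolding i_def
    by (intro null_ideal_add null_ideal_scale null_ideal_mult_right) auto
  have "1 = (c * c + d * d * k) *s 1 + i + (c * d + c * d) *s volume"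
    using M_hat_M null_ideal_mult_volume[OF cj(2)] null_ideal_mult_volume[OF hat_j]
    unfolding hat_M unfolding M cj(1) i_def scale_left_distrib
    by (simp add: k distrib_left distrib_right scale_mult_left scale_mult_right
        scale_right_distrib algebra_simps)
  then have one: "(c * d + c * d) *s volume = 1 - ((c * c + d * d * k) *s 1 + i)"
    by (simp add: algebra_simps)
  have "i \<in> Grassmann" using i null_ideal_subset by blast
  then have "(c * d + c * d) *s volume \<in> Grassmann"
    unfolding one by (intro Grassmann_diff Grassmann_add Grassmann_scale Grassmann_one)
  then have "c * d + c * d = 0" using volume_Grassmann_iff[OF n(3)] by blast
  then have "c = 0 \<or> d = 0" by (simp flip: mult_2)
  moreover have False if "c = 0" "d \<noteq> 0"
  proof -
    \<comment> \<open>For \<open>r \<noteq> 0\<close> the scalar \<open>k\<close> vanishes, which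
      would put \<open>1 = i\<close> into the null ideal.\<close>
    have "1 = (d * d * k) *s 1 + i" using one that by simp
    moreover have "k = 0" if "r \<noteq> 0"
      using volume_square_degenerate[OF that] k by simp
    ultimately have "r = 0" using i one_notin_null_ideal by (cases "r = 0") auto
    then have M_volume: "M = d *s volume"
      using null_ideal_trivial cj that by (simp add: M)
    have "volume * x = hat x * volume" for x
    proof (induction x rule: generated_induct)
      case (generator a)
      then show ?case using generator_mult_volume[of a] n(1) by (simp add: hat_generator)
    next
      case (mult x y)
      then show ?case by simp (metis mult.assoc)
    qed (simp_all add: distrib_left distrib_right scale_mult_left scale_mult_right)
    then have "M * T = T" using T by (simp add: M_volume scale_mult_left scale_mult_right)
    then have "M = 1" using inv invertible_cancel_right[of T M 1] by simp
    then show False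
      using scalar_volume_eq_iff[OF n(2), of 1 d] by (simp add: M_volume)
  qed
  ultimately have "d = 0" by blast
  then show ?thesis using l M by (simp add: M_def)
qed

text \<open>The case distinctions agree for two reasons: for even \<open>n\<close> with
  \<open>r \<noteq> n\<close>, allowing a top-grade part in the quotient adds nothing, and for
  \<open>r = n\<close> the quotient condition holds for every unit.\<close>

lemma P_Lambda_characterization:
  assumes n: "n \<ge> 1"
  shows "P_Lambda = (if odd n then P_pm * units (grade 0 + grade n) * units Grassmann
      else P_pm * units Grassmann)"
    and "P_Lambda = (if odd n \<and> r \<noteq> n
      then {T \<in> units UNIV. hat (mult_inv T) * T \<in> units (Grassmann + grade n)}
      else {T \<in> units UNIV. hat (mult_inv T) * T \<in> units Grassmann})"
    and "P_Lambda = (if r \<noteq> n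
      then {T \<in> units UNIV. hat (mult_inv T) * T \<in> units (Grassmann + grade n)}
      else units Grassmann)"
    and "P_pm_Lambda = (if odd n \<or> r = n
      then {T \<in> units UNIV. hat (mult_inv T) * T \<in> units Grassmann}
      else {T \<in> units UNIV. hat (mult_inv T) * T \<in> units (Grassmann + grade n)})"
proof -
  let ?Q = "\<lambda>A. {T \<in> units UNIV. hat (mult_inv T) * T \<in> units A}"
  have even_eq: "?Q (Grassmann + grade n) = ?Q Grassmann" if "even n" "r \<noteq> n"
    using ratio_Grassmann_even[OF that(1) n that(2)] Grassmann_subset_plus_top
    by (auto simp: units_def)
  \<comment> \<open>When \<open>r = n\<close> every generator is null, so \<Lambda> is the whole
    algebra.\<close>
  have all: "Grassmann = UNIV" "Grassmann + grade n = UNIV" if "r = n"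
  proof -
    have null: "{p + q + 1..n} = {1..n}" using that by auto
    show "Grassmann = UNIV" unfolding Grassmann_def null by (rule generated)
    then show "Grassmann + grade n = UNIV" using Grassmann_subset_plus_top by blast
  qed
  have Q_UNIV: "?Q UNIV = units UNIV" by (auto simp: units_def)
  show "P_Lambda = (if odd n then P_pm * units (grade 0 + grade n) * units Grassmann
      else P_pm * units Grassmann)"
    using P_Lambda_odd P_Lambda_even by (simp add: P_pm_Lambda_def pseudoscalar_plane_def)
  show second: "P_Lambda = (if odd n \<and> r \<noteq> n then ?Q (Grassmann + grade n) else ?Q Grassmann)"
    using P_Lambda_odd_eq_ratio P_Lambda_even P_pm_Lambda_eq_ratio all
    by (cases "odd n"; cases "r = n") simp_all
  show "P_Lambda = (if r \<noteq> n then ?Q (Grassmann + grade n) else units Grassmann)"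
    using second even_eq all Q_UNIV by (cases "odd n"; cases "r = n") simp_all
  show "P_pm_Lambda = (if odd n \<or> r = n then ?Q Grassmann else ?Q (Grassmann + grade n))"
    using P_pm_Lambda_eq_ratio even_eq by simp
qed

end

theorem theorem4p7:
  fixes scale :: "'f::real_or_complex \<Rightarrow> 'a::ring_1 \<Rightarrow> 'a"
    and e :: "nat \<Rightarrow> 'a" and p q r n :: nat
    and hat :: "'a \<Rightarrow> 'a" and G_par G_gr :: "nat \<Rightarrow> 'a set" and \<Lambda> :: "'a set"
  assumes "geometric_algebra scale e p q r"
    and n: "n = p + q + r" "n \<ge> 1"
    and hat: "hat = geometric_algebra.grade_involution scale e p q r"
    and G_par: "G_par = geometric_algebra.parity scale e p q r"
    and G_gr: "G_gr = geometric_algebra.grade scale e p q r"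
    and \<Lambda>: "\<Lambda> = geometric_algebra.Grassmann scale e p q r"
  shows
    "(geometric_algebra.P_Lambda scale e p q r =
       (if odd n then (units (G_par 0) \<union> units (G_par 1)) * units (G_gr 0 + G_gr n) * units \<Lambda>
        else (units (G_par 0) \<union> units (G_par 1)) * units \<Lambda>)) \<and>
     (geometric_algebra.P_Lambda scale e p q r =
       (if odd n \<and> r \<noteq> n then {T \<in> units UNIV. hat (mult_inv T) * T \<in> units (\<Lambda> + G_gr n)}
        else {T \<in> units UNIV. hat (mult_inv T) * T \<in> units \<Lambda>})) \<and>
     (geometric_algebra.P_Lambda scale e p q r =
       (if r \<noteq> n then {T \<in> units UNIV. hat (mult_inv T) * T \<in> units (\<Lambda> + G_gr n)}
        else units \<Lambda>)) \<and>
     (geometric_algebra.P_pm_Lambda scale e p q r =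
       (units (G_par 0) \<union> units (G_par 1)) * units \<Lambda>) \<and>
     (geometric_algebra.P_pm_Lambda scale e p q r =
       {T \<in> units UNIV. hat (mult_inv T) * T \<in> units \<Lambda>}) \<and>
     (geometric_algebra.P_pm_Lambda scale e p q r =
       (if odd n \<or> r = n then {T \<in> units UNIV. hat (mult_inv T) * T \<in> units \<Lambda>}
        else {T \<in> units UNIV. hat (mult_inv T) * T \<in> units (\<Lambda> + G_gr n)})) \<and>
     (units \<Lambda> = geometric_algebra.ker_twisted_ad scale e p q r)"
proof -
  interpret G: geometric_algebra scale e p q r by fact
  show ?thesis
    unfolding hat G_par G_gr \<Lambda> n(1) G.P_pm_def[symmetric]
    by (intro conjI G.P_Lambda_characterization n(2)[unfolded n(1)] G.P_pm_Lambda_def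
        G.P_pm_Lambda_eq_ratio G.units_Grassmann_eq_ker)
qed

end
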